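(* Let $(W,S)$ be a Coxeter system. If $\Gamma$ is an $S$-labeled digraph, then $\Gamma$ is a $W$-digraph if and only if $\Gamma_{\mathrm{rev}}$ is a $W$-digraph.
   Context: Coxeter system: $W$ has presentation $\langle s\in S\mid (rs)^{n(r,s)}=e \text{ for } r,s\in S,\ n(r,s)<\infty\rangle$ with $n(s,s)=1$ and $1<n(r,s)=n(s,r)\le\infty$ for $r\ne s$; $\ell$ is the length function. Hecke algebra: $u$ is an indeterminate and $H$ is the $\mathbb Q(u)$-algebra with basis $\{T_w\mid w\in W\}$ satisfying, for $s\in S$, $T_sT_w=T_{sw}$ if $\ell(sw)>\ell(w)$ and $T_sT_w=u^2T_{sw}+(u^2-1)T_w$ if $\ell(sw)<\ell(w)$. An $S$-labeled digraph is a directed multigraph $\Gamma$ with vertex set $\mathscr V(\Gamma)$ and edge set $\mathscr E(\Gamma)$, in which every edge is either solid or dashed and is labeled by an element of $S$ (written $\alpha\xrightarrow{s}\beta$ if solid, $\alpha\overset{s}{\dashrightarrow}\beta$ if dashed), such that $\Gamma$ has no loops and, for each $s\in S$, every vertex occurs in exactly one edge labeled $s$. Let $M(\Gamma)$ be the $\mathbb Q(u)$-vector space with basis $\mathscr V(\Gamma)$. For $s\in S$ let $\tau_s$ be the linear operator on $M(\Gamma)$ with, for each vertex $\alpha$ (where $\beta$ is the other endpoint of the edge labeled $s$ at $\alpha$): $\tau_s(\alpha)=\beta$ if the edge is $\alpha\xrightarrow{s}\beta$; $\tau_s(\alpha)=(u^2-1)\alpha+u^2\beta$ if it is $\beta\xrightarrow{s}\alpha$;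 $\tau_s(\alpha)=u\alpha+(u+1)\beta$ if it is $\alpha\overset{s}{\dashrightarrow}\beta$; $\tau_s(\alpha)=(u^2-u-1)\alpha+(u^2-u)\beta$ if it is $\beta\overset{s}{\dashrightarrow}\alpha$. An $S$-labeled digraph $\Gamma$ is a $W$-digraph if $T_s\mapsto\tau_s$ ($s\in S$) extends to a homomorphism of $\mathbb Q(u)$-algebras from $H$ to the algebra of all linear operators on $M(\Gamma)$. $\Gamma_{\mathrm{rev}}$ is the $S$-labeled digraph obtained from $\Gamma$ by reversing the direction of all edges while keeping their types (solid or dashed) and labels. *)

theory Defs
  imports
    "HOL-Algebra.Ring"
    "HOL-Algebra.Generated_Groups"
    "HOL-Computational_Algebra.Fraction_Field"
    "HOL-Computational_Algebra.Polynomial"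
    "HOL-Library.Extended_Nat"
    "HOL-Library.FuncSet"
    "HOL-Library.Poly_Mapping"
    "Graph_Theory.Digraph"
begin

section \<open>Group presentations and Coxeter systems\<close>

text \<open>
  A word is a list of signed letters: \<open>(s, True)\<close> stands for \<open>s\<close> and \<open>(s, False)\<close> for the
  formal inverse of \<open>s\<close>.  Two words over \<open>S\<close> are related by \<open>presentation_eq S R\<close> iff they
  represent the same element of the group with generators \<open>S\<close> and relators \<open>R\<close>, i.e. of the
  free group on \<open>S\<close> modulo the normal closure of \<open>R\<close>.
\<close>

type_synonym 'a word = "('a \<times> bool) list"

definition words :: "'a set \<Rightarrow> 'a word set" where
  "words S = lists (S \<times> UNIV)"

inductive presentation_eq :: "'a set \<Rightarrow> 'a word set \<Rightarrow> 'a word \<Rightarrow> 'a word \<Rightarrow> bool"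
  for S :: "'a set" and R :: "'a word set" where
  refl: "x \<in> words S \<Longrightarrow> presentation_eq S R x x"
| sym: "presentation_eq S R x y \<Longrightarrow> presentation_eq S R y x"
| trans: "presentation_eq S R x y \<Longrightarrow> presentation_eq S R y z \<Longrightarrow> presentation_eq S R x z"
| cancel: "x \<in> words S \<Longrightarrow> y \<in> words S \<Longrightarrow> s \<in> S \<Longrightarrow>
    presentation_eq S R (x @ [(s, b), (s, \<not> b)] @ y) (x @ y)"
| relator: "x \<in> words S \<Longrightarrow> y \<in> words S \<Longrightarrow> r \<in> R \<Longrightarrow>
    presentation_eq S R (x @ r @ y) (x @ y)"

definition word_value :: "('a, 'm) monoid_scheme \<Rightarrow> 'a word \<Rightarrow> 'a" where
  "word_value G x =
     foldr (\<lambda>(s, b) g. (if b then s else inv\<^bsub>G\<^esub> s) \<otimes>\<^bsub>G\<^esub> g) x \<one>\<^bsub>G\<^esub>"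

definition has_presentation :: "('a, 'm) monoid_scheme \<Rightarrow> 'a set \<Rightarrow> 'a word set \<Rightarrow> bool" where
  "has_presentation G S R \<longleftrightarrow>
     group G \<and> S \<subseteq> carrier G \<and> R \<subseteq> words S \<and>
     generate G S = carrier G \<and>
     (\<forall>x \<in> words S. \<forall>y \<in> words S.
        word_value G x = word_value G y \<longleftrightarrow> presentation_eq S R x y)"

definition coxeter_relators :: "'a set \<Rightarrow> ('a \<Rightarrow> 'a \<Rightarrow> enat) \<Rightarrow> 'a word set" where
  "coxeter_relators S n =
     {concat (replicate k [(r, True), (s, True)]) | r s k. r \<in> S \<and> s \<in> S \<and> n r s = enat k}"

definition coxeter_system :: "('a, 'm) monoid_scheme \<Rightarrow> 'a set \<Rightarrow> bool" where
  "coxeter_system W S \<longleftrightarrow>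
     (\<exists>n :: 'a \<Rightarrow> 'a \<Rightarrow> enat.
        (\<forall>s \<in> S. n s s = 1) \<and>
        (\<forall>r \<in> S. \<forall>s \<in> S. r \<noteq> s \<longrightarrow> 1 < n r s \<and> n r s = n s r) \<and>
        has_presentation W S (coxeter_relators S n))"

definition coxeter_length :: "('a, 'm) monoid_scheme \<Rightarrow> 'a set \<Rightarrow> 'a \<Rightarrow> nat" where
  "coxeter_length W S w =
     (LEAST k. \<exists>ss \<in> lists S. length ss = k \<and> foldr (\<otimes>\<^bsub>W\<^esub>) ss \<one>\<^bsub>W\<^esub> = w)"


section \<open>Vector spaces with a given basis over the field of rational functions\<close>

type_synonym ratfun = "rat poly fract"

definition indet :: ratfun where
  "indet = Fraction_Field.Fract [:0, 1:] 1"

definition scale :: "ratfun \<Rightarrow> ('x \<Rightarrow>\<^sub>0 ratfun) \<Rightarrow> ('x \<Rightarrow>\<^sub>0 ratfun)" where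
  "scale c x = Poly_Mapping.map ((*) c) x"

definition free_space :: "'x set \<Rightarrow> ('x \<Rightarrow>\<^sub>0 ratfun) set" where
  "free_space X = {x. Poly_Mapping.keys x \<subseteq> X}"

definition basis_vec :: "'x \<Rightarrow> ('x \<Rightarrow>\<^sub>0 ratfun)" where
  "basis_vec a = Poly_Mapping.single a 1"

text \<open>
  Operators are restricted to the space (they are \<open>undefined\<close> outside it), so that equality of
  operators is equality of functions.
\<close>

definition linear_operators ::
    "'x set \<Rightarrow> (('x \<Rightarrow>\<^sub>0 ratfun) \<Rightarrow> ('x \<Rightarrow>\<^sub>0 ratfun)) set" where
  "linear_operators X =
     {f \<in> free_space X \<rightarrow>\<^sub>E free_space X.
        (\<forall>x \<in> free_space X. \<forall>y \<in> free_space X. f (x + y) = f x + f y) \<and>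
        (\<forall>c. \<forall>x \<in> free_space X. f (scale c x) = scale c (f x))}"

definition operator_algebra ::
    "'x set \<Rightarrow> (('x \<Rightarrow>\<^sub>0 ratfun) \<Rightarrow> ('x \<Rightarrow>\<^sub>0 ratfun)) ring" where
  "operator_algebra X =
     \<lparr>carrier = linear_operators X,
      monoid.mult = (\<lambda>f g. compose (free_space X) f g),
      one = (\<lambda>x \<in> free_space X. x),
      zero = (\<lambda>x \<in> free_space X. 0),
      add = (\<lambda>f g. \<lambda>x \<in> free_space X. f x + g x)\<rparr>"

definition scale_operator ::
    "'x set \<Rightarrow> ratfun \<Rightarrow> (('x \<Rightarrow>\<^sub>0 ratfun) \<Rightarrow> ('x \<Rightarrow>\<^sub>0 ratfun)) \<Rightarrow> (('x \<Rightarrow>\<^sub>0 ratfun) \<Rightarrow> ('x \<Rightarrow>\<^sub>0 ratfun))"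
  where "scale_operator X c f = (\<lambda>x \<in> free_space X. scale c (f x))"


section \<open>The Hecke algebra\<close>

text \<open>
  The vector space underlying the Hecke algebra is the free space on the elements of \<open>W\<close>, with
  \<open>basis_vec w\<close> in the role of \<open>T\<^sub>w\<close>; \<open>hecke_algebra W S H\<close> says that the ring \<open>H\<close> is
  an associative unital algebra structure on this space with the defining products.  The unit is
  not required to be \<open>T\<^sub>e\<close>.
\<close>

definition hecke_algebra ::
    "('a, 'm) monoid_scheme \<Rightarrow> 'a set \<Rightarrow> ('a \<Rightarrow>\<^sub>0 ratfun) ring \<Rightarrow> bool" where
  "hecke_algebra W S H \<longleftrightarrow>
     ring H \<and>
     carrier H = free_space (carrier W) \<and>
     \<zero>\<^bsub>H\<^esub> = 0 \<and>
     (\<forall>x \<in> carrier H. \<forall>y \<in> carrier H. x \<oplus>\<^bsub>H\<^esub> y = x + y) \<and>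
     (\<forall>c. \<forall>x \<in> carrier H. \<forall>y \<in> carrier H.
        scale c x \<otimes>\<^bsub>H\<^esub> y = scale c (x \<otimes>\<^bsub>H\<^esub> y) \<and>
        x \<otimes>\<^bsub>H\<^esub> scale c y = scale c (x \<otimes>\<^bsub>H\<^esub> y)) \<and>
     (\<forall>s \<in> S. \<forall>w \<in> carrier W.
        (coxeter_length W S (s \<otimes>\<^bsub>W\<^esub> w) > coxeter_length W S w \<longrightarrow>
           basis_vec s \<otimes>\<^bsub>H\<^esub> basis_vec w = basis_vec (s \<otimes>\<^bsub>W\<^esub> w)) \<and>
        (coxeter_length W S (s \<otimes>\<^bsub>W\<^esub> w) < coxeter_length W S w \<longrightarrow>
           basis_vec s \<otimes>\<^bsub>H\<^esub> basis_vec w =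
             scale (indet\<^sup>2) (basis_vec (s \<otimes>\<^bsub>W\<^esub> w)) + scale (indet\<^sup>2 - 1) (basis_vec w)))"


section \<open>Labeled digraphs\<close>

text \<open>An arc points from its \<^const>\<open>tail\<close> to its \<^const>\<open>head\<close>; it is dashed iff it is not solid.\<close>

record ('v, 'e, 's) labeled_digraph = "('v, 'e) pre_digraph" +
  solid :: "'e \<Rightarrow> bool"
  arc_label :: "'e \<Rightarrow> 's"

definition incident_arc :: "('v, 'e, 's) labeled_digraph \<Rightarrow> 's \<Rightarrow> 'v \<Rightarrow> 'e \<Rightarrow> bool" where
  "incident_arc \<Gamma> s \<alpha> e \<longleftrightarrow>
     e \<in> arcs \<Gamma> \<and> arc_label \<Gamma> e = s \<and> (tail \<Gamma> e = \<alpha> \<or> head \<Gamma> e = \<alpha>)"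

definition S_labeled_digraph :: "'s set \<Rightarrow> ('v, 'e, 's) labeled_digraph \<Rightarrow> bool" where
  "S_labeled_digraph S \<Gamma> \<longleftrightarrow>
     loopfree_digraph (pre_digraph.truncate \<Gamma>) \<and>
     (\<forall>e \<in> arcs \<Gamma>. arc_label \<Gamma> e \<in> S) \<and>
     (\<forall>s \<in> S. \<forall>\<alpha> \<in> verts \<Gamma>. \<exists>!e. incident_arc \<Gamma> s \<alpha> e)"

definition rev_digraph :: "('v, 'e, 's) labeled_digraph \<Rightarrow> ('v, 'e, 's) labeled_digraph" where
  "rev_digraph \<Gamma> = \<Gamma>\<lparr>tail := head \<Gamma>, head := tail \<Gamma>\<rparr>"

definition tau_vertex ::
    "('v, 'e, 's) labeled_digraph \<Rightarrow> 's \<Rightarrow> 'v \<Rightarrow> ('v \<Rightarrow>\<^sub>0 ratfun)" where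
  "tau_vertex \<Gamma> s \<alpha> =
     (let e = (THE e. incident_arc \<Gamma> s \<alpha> e) in
      if solid \<Gamma> e then
        if tail \<Gamma> e = \<alpha> then basis_vec (head \<Gamma> e)
        else scale (indet\<^sup>2 - 1) (basis_vec \<alpha>) + scale (indet\<^sup>2) (basis_vec (tail \<Gamma> e))
      else
        if tail \<Gamma> e = \<alpha> then
          scale indet (basis_vec \<alpha>) + scale (indet + 1) (basis_vec (head \<Gamma> e))
        else
          scale (indet\<^sup>2 - indet - 1) (basis_vec \<alpha>)
            + scale (indet\<^sup>2 - indet) (basis_vec (tail \<Gamma> e)))"

definition tau ::
    "('v, 'e, 's) labeled_digraph \<Rightarrow> 's \<Rightarrow> ('v \<Rightarrow>\<^sub>0 ratfun) \<Rightarrow> ('v \<Rightarrow>\<^sub>0 ratfun)" where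
  "tau \<Gamma> s =
     (\<lambda>x \<in> free_space (verts \<Gamma>).
        \<Sum>\<alpha> \<in> Poly_Mapping.keys x. scale (Poly_Mapping.lookup x \<alpha>) (tau_vertex \<Gamma> s \<alpha>))"

definition W_digraph ::
    "'a set \<Rightarrow> ('a \<Rightarrow>\<^sub>0 ratfun) ring \<Rightarrow> ('v, 'e, 'a) labeled_digraph \<Rightarrow> bool" where
  "W_digraph S H \<Gamma> \<longleftrightarrow>
     S_labeled_digraph S \<Gamma> \<and>
     (\<exists>\<phi> \<in> ring_hom H (operator_algebra (verts \<Gamma>)).
        (\<forall>c. \<forall>x \<in> carrier H. \<phi> (scale c x) = scale_operator (verts \<Gamma>) c (\<phi> x)) \<and>
        (\<forall>s \<in> S. \<phi> (basis_vec s) = tau \<Gamma> s))"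

end

theory Submission
  imports Defs
begin

text \<open>
  Write \<open>\<tau>\<^sub>s\<close> and \<open>\<tau>'\<^sub>s\<close> for the operators of \<open>\<Gamma>\<close> and of its reversal.  The quadratic relation
  \<open>\<tau>\<^sub>s\<^sup>2 = u\<^sup>2 + (u\<^sup>2 - 1) \<tau>\<^sub>s\<close> holds for every labeled digraph (lemma \<open>quadratic_relation\<close>), so
  being a W-digraph is a matter of the braid relations, and each of those involves only two
  generators \<open>r\<close> and \<open>s\<close>.

  Put \<open>\<theta>\<^sub>s = (u\<^sup>2 - 1) - \<tau>\<^sub>s\<close>, which is \<open>- u\<^sup>2\<close> times the inverse of \<open>\<tau>\<^sub>s\<close>.  In the basis of
  vertices, the transpose of \<open>\<theta>\<^sub>s\<close> has the same diagonal as \<open>\<tau>'\<^sub>s\<close>, and its off-diagonal entries are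
  those of \<open>\<tau>'\<^sub>s\<close> with the opposite sign.  The arcs labeled \<open>r\<close> or \<open>s\<close> alone form paths and cycles
  of even length (two arcs with the same ends being a cycle of length two), so there is a sign
  \<open>c\<close> on the vertices that changes along each of these arcs
  (lemma \<open>two_coloring_of_two_matchings\<close>).  Conjugation by \<open>c\<close> repairs the off-diagonal signs: for the
  symmetric bilinear form in which the vertices are orthogonal and \<open>\<alpha>\<close> has square length \<open>c \<alpha>\<close>,
  \<open>\<tau>'\<^sub>r\<close> and \<open>\<tau>'\<^sub>s\<close> are adjoint to \<open>\<theta>\<^sub>r\<close> and \<open>\<theta>\<^sub>s\<close> (lemma \<open>pairing_tau_rev\<close>).  An equation between
  two products of \<open>\<tau>\<^sub>r\<close> and \<open>\<tau>\<^sub>s\<close> with equally many factors passes to inverses, hence to the \<open>\<theta>\<close> with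
  the order of the factors reversed, and by adjunction to \<open>\<tau>'\<^sub>r\<close> and \<open>\<tau>'\<^sub>s\<close> in the original order
  (lemma \<open>two_letter_relation_rev\<close>).  A single sign that changes along all arcs need not exist,
  since a cycle with three labels may be odd; therefore the twist cannot be applied to the
  whole representation at once, only to one braid relation at a time.

  It remains to pass between representations and braid relations.  If \<open>x\<close> and \<open>y\<close> are reduced
  words for the same element \<open>w\<close>, both multiply out to \<open>T\<^sub>w\<close> in the Hecke algebra; so a
  representation satisfies every braid relation whose two sides, the words \<open>r s r \<dots>\<close> and
  \<open>s r s \<dots>\<close> of equal length, are reduced words of the same element.  Conversely, Matsumoto's theorem
  (lemma \<open>matsumoto_reduced_words\<close>) says that a function on words that is compatible with adding letters
  at either end and takes equal values on the two sides of each such relation is constant on the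
  reduced words of an element.  This makes
  the product of the \<open>\<tau>'\<close> along a reduced word of \<open>w\<close> a function of \<open>w\<close>, and its linear extension is
  the representation that is sought (lemma \<open>W_digraph_of_braid_relations\<close>).  Matsumoto's theorem rests on the
  exchange condition, which follows from the presentation because the parity with which a reflection
  occurs along a word depends only on the value of the word.
\<close>

section \<open>Reduced words in a Coxeter group\<close>

fun alternating_word :: "'a \<Rightarrow> 'a \<Rightarrow> nat \<Rightarrow> 'a list" where
  "alternating_word r s 0 = []"
| "alternating_word r s (Suc k) = r # alternating_word s r k"

lemma length_alternating_word [simp]: "length (alternating_word r s k) = k"
  by (induction r s k rule: alternating_word.induct) auto

lemma set_alternating_word: "set (alternating_word r s k) \<subseteq> {r, s}"
  by (induction r s k rule: alternating_word.induct) auto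

lemma take_alternating_word: "take j (alternating_word r s k) = alternating_word r s (min j k)"
proof (induction r s k arbitrary: j rule: alternating_word.induct)
  case (2 r s k)
  then show ?case by (cases j) auto
qed simp

locale coxeter_presentation = group W for W :: "('a, 'm) monoid_scheme" (structure) +
  fixes S :: "'a set" and n :: "'a \<Rightarrow> 'a \<Rightarrow> enat"
  assumes order_self: "s \<in> S \<Longrightarrow> n s s = 1"
    and presentation: "has_presentation W S (coxeter_relators S n)"
begin

abbreviation len :: "'a \<Rightarrow> nat" where
  "len \<equiv> coxeter_length W S"

abbreviation equivalent_words :: "'a word \<Rightarrow> 'a word \<Rightarrow> bool" where
  "equivalent_words \<equiv> presentation_eq S (coxeter_relators S n)"

definition val :: "'a list \<Rightarrow> 'a" where
  "val ss = foldr (\<otimes>) ss \<one>"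

definition reduced :: "'a list \<Rightarrow> bool" where
  "reduced ss \<longleftrightarrow> ss \<in> lists S \<and> length ss = len (val ss)"

lemma generator_closed [simp]: "s \<in> S \<Longrightarrow> s \<in> carrier W"
  using presentation by (auto simp: has_presentation_def)

lemma relators_words: "coxeter_relators S n \<subseteq> words S"
  using presentation by (auto simp: has_presentation_def)

lemma word_value_eq_iff:
  "x \<in> words S \<Longrightarrow> y \<in> words S \<Longrightarrow> word_value W x = word_value W y \<longleftrightarrow> equivalent_words x y"
  using presentation by (auto simp: has_presentation_def)

lemma val_simps [simp]: "val [] = \<one>" "val (s # ss) = s \<otimes> val ss"
  by (simp_all add: val_def)

lemma val_closed [simp]: "ss \<in> lists S \<Longrightarrow> val ss \<in> carrier W"
  by (induction ss) auto

lemma val_append: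
  "xs \<in> lists S \<Longrightarrow> ys \<in> lists S \<Longrightarrow> val (xs @ ys) = val xs \<otimes> val ys"
  by (induction xs) (auto simp: m_assoc)

lemma generator_square [simp]:
  assumes "s \<in> S"
  shows "s \<otimes> s = \<one>"
proof -
  let ?x = "[(s, True), (s, True)]"
  have "?x = concat (replicate 1 ?x)" by simp
  moreover have "n s s = enat 1" using order_self[OF assms] by (simp add: one_enat_def)
  ultimately have "?x \<in> coxeter_relators S n"
    unfolding coxeter_relators_def using assms by blast
  then have "equivalent_words ([] @ ?x @ []) ([] @ [])"
    by (intro presentation_eq.relator) (auto simp: words_def)
  then have "word_value W ?x = word_value W []"
    using word_value_eq_iff[of ?x "[]"] assms by (auto simp: words_def)
  then show ?thesis using assms by (simp add: word_value_def)
qed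

lemma val_replicate:
  assumes "r \<in> S" "s \<in> S"
  shows "val (concat (replicate k [r, s])) = (r \<otimes> s) [^] k"
proof (induction k)
  case (Suc k)
  then have "val (concat (replicate (Suc k) [r, s])) = (r \<otimes> s) \<otimes> (r \<otimes> s) [^] k"
    using assms by (simp add: m_assoc)
  also have "\<dots> = (r \<otimes> s) [^] Suc k" using assms by (metis nat_pow_Suc2 m_closed generator_closed)
  finally show ?case .
qed simp

lemma generator_inv [simp]: "s \<in> S \<Longrightarrow> inv s = s"
  by (simp add: inv_equality)

lemma generator_cancel [simp]: "s \<in> S \<Longrightarrow> w \<in> carrier W \<Longrightarrow> s \<otimes> (s \<otimes> w) = w"
  by (simp add: m_assoc[symmetric])

lemma word_value_eq_val: "x \<in> words S \<Longrightarrow> word_value W x = val (map fst x)"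
  by (induction x) (auto simp: words_def word_value_def)

lemma val_surj:
  assumes "w \<in> carrier W"
  shows "\<exists>ss \<in> lists S. val ss = w"
proof -
  have "w \<in> generate W S"
    using assms presentation by (auto simp: has_presentation_def)
  then show ?thesis
  proof (induction rule: generate.induct)
    case one
    then show ?case by (intro bexI[of _ "[]"]) auto
  next
    case (incl s)
    then show ?case by (intro bexI[of _ "[s]"]) auto
  next
    case (inv s)
    then show ?case by (intro bexI[of _ "[s]"]) auto
  next
    case (eng v w)
    then obtain xs ys where "xs \<in> lists S" "ys \<in> lists S" "val xs = v" "val ys = w" by auto
    then show ?case by (intro bexI[of _ "xs @ ys"]) (auto simp: val_append)
  qed
qed

text \<open>
  For a word \<open>s\<^sub>1 \<dots> s\<^sub>k\<close>, the parity of the number of indices \<open>i\<close> for which the reflection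
  \<open>s\<^sub>1 \<dots> s\<^sub>i \<dots> s\<^sub>1\<close> equals \<open>t\<close>.  Geometrically it tells whether the gallery of the word ends on
  the far side of the wall of \<open>t\<close>.
\<close>
fun refl_parity :: "'a list \<Rightarrow> 'a \<Rightarrow> bool" where
  "refl_parity [] t = False"
| "refl_parity (s # ss) t = ((t = s) \<noteq> refl_parity ss (s \<otimes> t \<otimes> s))"

lemma refl_parity_append:
  assumes "xs \<in> lists S" "ys \<in> lists S" "t \<in> carrier W"
  shows "refl_parity (xs @ ys) t =
    (refl_parity xs t \<noteq> refl_parity ys (inv (val xs) \<otimes> t \<otimes> val xs))"
  using assms
proof (induction xs arbitrary: t)
  case (Cons s xs)
  then have "inv (val (s # xs)) \<otimes> t \<otimes> val (s # xs)
      = inv (val xs) \<otimes> (s \<otimes> t \<otimes> s) \<otimes> val xs"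
    by (simp add: inv_mult_group m_assoc)
  with Cons show ?case by simp blast
qed simp

text \<open>
  The reflections along \<open>r s r s \<dots>\<close> are \<open>c\<^sup>j r\<close> for \<open>c = r s\<close> and \<open>j = 0, 1, \<dots>\<close>.
\<close>
lemma refl_parity_relator:
  assumes r: "r \<in> S" and s: "s \<in> S" and t: "t \<in> carrier W"
  shows "refl_parity (concat (replicate k [r, s])) t =
    odd (card {j. j < 2 * k \<and> t = (r \<otimes> s) [^] j \<otimes> r})"
proof (induction k)
  case (Suc k)
  let ?c = "r \<otimes> s"
  have c: "?c \<in> carrier W" using r s by simp
  have rc: "r \<otimes> inv (?c [^] k) = ?c [^] k \<otimes> r" for k :: nat
  proof (induction k)
    case (Suc k)
    have "r \<otimes> inv (?c [^] Suc k) = r \<otimes> (inv ?c \<otimes> inv (?c [^] k))"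
      using c by (simp add: inv_mult_group)
    also have "\<dots> = ?c \<otimes> (r \<otimes> inv (?c [^] k))"
      using r s c by (simp add: inv_mult_group m_assoc)
    also have "\<dots> = ?c \<otimes> ?c [^] k \<otimes> r" using c r by (simp add: Suc m_assoc)
    also have "\<dots> = ?c [^] Suc k \<otimes> r" using c by (metis nat_pow_Suc2)
    finally show ?case .
  qed (use r in simp)
  have conj_eq: "inv v \<otimes> t \<otimes> v = x \<longleftrightarrow> t = v \<otimes> x \<otimes> inv v"
    if "v \<in> carrier W" "x \<in> carrier W" for v x
    using that t by (metis inv_closed inv_solve_left inv_solve_right m_closed m_assoc)
  have pow: "?c [^] i \<otimes> ?c [^] j = ?c [^] (i + j)" for i j :: nat
    using c by (simp add: nat_pow_mult)
  let ?t = "inv (?c [^] k) \<otimes> t \<otimes> ?c [^] k"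
  have t': "?t \<in> carrier W" using t c by simp
  have 1: "?t = r \<longleftrightarrow> t = ?c [^] (2 * k) \<otimes> r"
  proof -
    have "?c [^] k \<otimes> r \<otimes> inv (?c [^] k) = ?c [^] (2 * k) \<otimes> r"
      using c r rc[of k] by (simp add: m_assoc) (simp add: m_assoc[symmetric] pow mult_2)
    with conj_eq[of "?c [^] k" r] c r show ?thesis by simp
  qed
  have 2: "r \<otimes> ?t \<otimes> r = s \<longleftrightarrow> t = ?c [^] Suc (2 * k) \<otimes> r"
  proof -
    have "r \<otimes> ?t \<otimes> r = s \<longleftrightarrow> ?t = r \<otimes> s \<otimes> r"
    proof
      assume "r \<otimes> ?t \<otimes> r = s"
      then have "r \<otimes> s \<otimes> r = r \<otimes> (r \<otimes> ?t \<otimes> r) \<otimes> r" by simp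
      also have "\<dots> = ?t" using r t' by (simp add: m_assoc)
      finally show "?t = r \<otimes> s \<otimes> r" by simp
    next
      assume "?t = r \<otimes> s \<otimes> r"
      then have "r \<otimes> ?t \<otimes> r = r \<otimes> (r \<otimes> s \<otimes> r) \<otimes> r" by simp
      also have "\<dots> = s" using r s by (simp add: m_assoc)
      finally show "r \<otimes> ?t \<otimes> r = s" .
    qed
    also have "\<dots> \<longleftrightarrow> t = ?c [^] k \<otimes> (?c \<otimes> r) \<otimes> inv (?c [^] k)"
      using conj_eq[of "?c [^] k" "?c \<otimes> r"] c r by simp
    also have "?c [^] k \<otimes> (?c \<otimes> r) \<otimes> inv (?c [^] k) = ?c [^] Suc k \<otimes> (r \<otimes> inv (?c [^] k))"
      using c r s by (simp add: m_assoc)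
    also have "\<dots> = ?c [^] Suc k \<otimes> ?c [^] k \<otimes> r"
      unfolding rc using c r by (intro m_assoc[symmetric]) auto
    also have "\<dots> = ?c [^] Suc (2 * k) \<otimes> r"
      unfolding pow by (simp add: mult_2)
    finally show ?thesis .
  qed
  have "{j. j < 2 * Suc k \<and> t = ?c [^] j \<otimes> r} =
      {j. j < 2 * k \<and> t = ?c [^] j \<otimes> r} \<union> {j. j = 2 * k \<and> ?t = r}
        \<union> {j. j = Suc (2 * k) \<and> r \<otimes> ?t \<otimes> r = s}"
    unfolding 1 2 by (auto simp: less_Suc_eq)
  moreover have "card \<dots> = card {j. j < 2 * k \<and> t = ?c [^] j \<otimes> r}
      + card {j. j = 2 * k \<and> ?t = r} + card {j. j = Suc (2 * k) \<and> r \<otimes> ?t \<otimes> r = s}"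
    by (subst card_Un_disjoint; (subst card_Un_disjoint)?) auto
  moreover have "card {j. j = i \<and> P} = of_bool P" for i :: nat and P by (cases P) auto
  ultimately have card: "card {j. j < 2 * Suc k \<and> t = ?c [^] j \<otimes> r} =
      card {j. j < 2 * k \<and> t = ?c [^] j \<otimes> r} + of_bool (?t = r) + of_bool (r \<otimes> ?t \<otimes> r = s)"
    by simp
  have split: "concat (replicate (Suc k) [r, s]) = concat (replicate k [r, s]) @ [r, s]"
    by (induction k) auto
  have "concat (replicate k [r, s]) \<in> lists S" using r s by (induction k) auto
  then have "refl_parity (concat (replicate (Suc k) [r, s])) t =
      (refl_parity (concat (replicate k [r, s])) t \<noteq> refl_parity [r, s] ?t)"
    unfolding split using r s t by (subst refl_parity_append) (auto simp: val_replicate)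
  also have "\<dots> = odd (card {j. j < 2 * Suc k \<and> t = ?c [^] j \<otimes> r})"
    unfolding card Suc.IH by auto
  finally show ?case .
qed simp

text \<open>
  If \<open>c\<^sup>k = 1\<close>, the sequence \<open>c\<^sup>j r\<close> for \<open>j < 2 k\<close> runs twice through the same list, so every
  reflection occurs an even number of times.
\<close>
lemma refl_parity_relator_trivial:
  assumes r: "r \<in> S" and s: "s \<in> S" and t: "t \<in> carrier W" and k: "(r \<otimes> s) [^] (k::nat) = \<one>"
  shows "\<not> refl_parity (concat (replicate k [r, s])) t"
proof -
  let ?A = "{j::nat. j < k \<and> t = (r \<otimes> s) [^] j \<otimes> r}"
  have c: "r \<otimes> s \<in> carrier W" using r s by simp
  have shift: "(r \<otimes> s) [^] (k + j) = (r \<otimes> s) [^] j" for j :: nat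
    using c k by (metis l_one nat_pow_closed nat_pow_mult)
  have "{j::nat. j < 2 * k \<and> t = (r \<otimes> s) [^] j \<otimes> r} = ?A \<union> (\<lambda>j. k + j) ` ?A"
  proof (rule Set.set_eqI)
    fix j :: nat
    show "j \<in> {j::nat. j < 2 * k \<and> t = (r \<otimes> s) [^] j \<otimes> r} \<longleftrightarrow> j \<in> ?A \<union> (\<lambda>j. k + j) ` ?A"
    proof (cases "j < k")
      case False
      then obtain i where "j = k + i" by (metis le_Suc_ex not_less)
      then show ?thesis by (auto simp: shift)
    qed auto
  qed
  moreover have "card (?A \<union> (\<lambda>j. k + j) ` ?A) = card ?A + card ((\<lambda>j. k + j) ` ?A)"
    by (intro card_Un_disjoint) auto
  moreover have "card ((\<lambda>j. k + j) ` ?A) = card ?A"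
    by (intro card_image) (auto simp: inj_on_def)
  ultimately show ?thesis unfolding refl_parity_relator[OF r s t] by simp
qed

lemma map_fst_word: "x \<in> words S \<Longrightarrow> map fst x \<in> lists S"
  unfolding words_def by (auto simp: in_lists_conv_set)

lemma words_append: "x @ y \<in> words S \<longleftrightarrow> x \<in> words S \<and> y \<in> words S"
  by (auto simp: words_def)

text \<open>
  Inserting a relator or a pair of mutually inverse letters changes neither the parity of the length nor
  any \<^const>\<open>refl_parity\<close>; together with the presentation this makes both parities
  functions of the value of a word.
\<close>
lemma equivalent_words_invariants:
  assumes "equivalent_words x y"
  shows "x \<in> words S \<and> y \<in> words S \<and> (even (length x) \<longleftrightarrow> even (length y)) \<and>
    (\<forall>t \<in> carrier W. refl_parity (map fst x) t = refl_parity (map fst y) t)"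
proof -
  have drop: "refl_parity (map fst (x @ z @ y)) t = refl_parity (map fst (x @ y)) t"
    if "x \<in> words S" "y \<in> words S" "z \<in> words S" "t \<in> carrier W"
      "val (map fst z) = \<one>" "\<And>t. t \<in> carrier W \<Longrightarrow> \<not> refl_parity (map fst z) t"
    for x y z t
    using that by (simp add: map_fst_word refl_parity_append)
  show ?thesis
    using assms
  proof (induction rule: presentation_eq.induct)
    case (cancel x y s b)
    let ?z = "[(s, b), (s, \<not> b)]"
    have "s \<otimes> t \<otimes> s = s \<longleftrightarrow> t = s" if t: "t \<in> carrier W" for t
    proof
      assume "s \<otimes> t \<otimes> s = s"
      then have "s \<otimes> (s \<otimes> t \<otimes> s) \<otimes> s = s \<otimes> s \<otimes> s" by simp
      then show "t = s" using t cancel by (simp add: m_assoc)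
    qed (use cancel in \<open>simp add: m_assoc\<close>)
    then have trivial: "\<not> refl_parity (map fst ?z) t" if "t \<in> carrier W" for t
      using that by simp
    have z: "?z \<in> words S" using cancel by (simp add: words_def)
    have "val (map fst ?z) = \<one>" using cancel by simp
    then have "refl_parity (map fst (x @ ?z @ y)) t = refl_parity (map fst (x @ y)) t"
      if "t \<in> carrier W" for t
      using drop[OF cancel(1,2) z that _ trivial] by blast
    then show ?case using z cancel words_append[of ?z y] by (simp add: words_append)
  next
    case (relator x y z)
    then have z: "z \<in> words S" using relators_words by auto
    from relator obtain r s k where rs: "r \<in> S" "s \<in> S"
      and z_eq: "z = concat (replicate k [(r, True), (s, True)])"
      unfolding coxeter_relators_def by auto
    have fst_z: "map fst z = concat (replicate k [r, s])"
      by (simp add: z_eq map_concat)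
    have "equivalent_words ([] @ z @ []) ([] @ [])"
      using relator by (intro presentation_eq.relator) (auto simp: words_def)
    then have "word_value W z = word_value W []"
      using word_value_eq_iff[OF z, of "[]"] by (simp add: words_def)
    then have val_z: "val (map fst z) = \<one>"
      using word_value_eq_val[OF z] by (simp add: word_value_def)
    have "(r \<otimes> s) [^] k = \<one>" using val_z fst_z val_replicate[OF rs, of k] by simp
    then have "\<not> refl_parity (map fst z) t" if "t \<in> carrier W" for t
      unfolding fst_z using refl_parity_relator_trivial rs that by blast
    then have "refl_parity (map fst (x @ z @ y)) t = refl_parity (map fst (x @ y)) t"
      if "t \<in> carrier W" for t
      using drop[OF relator(1,2) z that val_z] that by blast
    moreover have "even (length z)" unfolding z_eq by (induction k) auto
    ultimately show ?case using relator z by (simp add: words_append)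
  qed auto
qed

lemma val_eq_invariants:
  assumes "xs \<in> lists S" "ys \<in> lists S" "val xs = val ys"
  shows "even (length xs) \<longleftrightarrow> even (length ys)"
    and "t \<in> carrier W \<Longrightarrow> refl_parity xs t = refl_parity ys t"
proof -
  let ?w = "map (\<lambda>s. (s, True))"
  have "?w zs \<in> words S" if "zs \<in> lists S" for zs :: "'a list" using that by (auto simp: words_def)
  then have "equivalent_words (?w xs) (?w ys)"
    using assms word_value_eq_iff[of "?w xs" "?w ys"] by (simp add: word_value_eq_val comp_def)
  from equivalent_words_invariants[OF this]
  show "even (length xs) \<longleftrightarrow> even (length ys)"
    and "t \<in> carrier W \<Longrightarrow> refl_parity xs t = refl_parity ys t"
    by (auto simp: comp_def)
qed

lemma len_le: "ss \<in> lists S \<Longrightarrow> len (val ss) \<le> length ss"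
  unfolding coxeter_length_def val_def by (rule Least_le) auto

lemma reduced_word_exists:
  assumes "w \<in> carrier W"
  shows "\<exists>ss. reduced ss \<and> val ss = w"
proof -
  have "\<exists>k. \<exists>ss \<in> lists S. length ss = k \<and> foldr (\<otimes>) ss \<one> = w"
    using val_surj[OF assms] by (auto simp: val_def)
  then have "\<exists>ss \<in> lists S. length ss = len w \<and> foldr (\<otimes>) ss \<one> = w"
    unfolding coxeter_length_def by (rule LeastI_ex)
  then show ?thesis by (auto simp: reduced_def val_def)
qed

lemma len_generator_mult:
  assumes s: "s \<in> S" and w: "w \<in> carrier W"
  shows "len (s \<otimes> w) = Suc (len w) \<or> len w = Suc (len (s \<otimes> w))"
proof -
  from reduced_word_exists[OF w] obtain xs where xs: "reduced xs" "val xs = w" by auto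
  from reduced_word_exists[of "s \<otimes> w"] s w obtain ys
    where ys: "reduced ys" "val ys = s \<otimes> w" by auto
  have "len (val (s # xs)) \<le> length (s # xs)" "len (val (s # ys)) \<le> length (s # ys)"
    using s xs ys by (intro len_le; simp add: reduced_def)+
  moreover have "even (length (s # xs)) \<longleftrightarrow> even (length ys)"
    using s xs ys by (intro val_eq_invariants) (auto simp: reduced_def)
  ultimately show ?thesis using xs ys s w unfolding reduced_def by simp presburger
qed

lemma reduced_Cons:
  assumes "reduced (s # ss)"
  shows "s \<in> S" "reduced ss" "len (s \<otimes> val ss) = Suc (len (val ss))"
proof -
  show s: "s \<in> S" using assms by (simp add: reduced_def)
  have "len (val ss) \<le> length ss" using assms by (intro len_le) (simp add: reduced_def)
  then show "reduced ss" "len (s \<otimes> val ss) = Suc (len (val ss))"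
    using assms len_generator_mult[of s "val ss"] by (auto simp: reduced_def)
qed

lemma reduced_ConsI:
  "s \<in> S \<Longrightarrow> reduced ss \<Longrightarrow> len (s \<otimes> val ss) > len (val ss) \<Longrightarrow> reduced (s # ss)"
  using len_generator_mult[of s "val ss"] by (auto simp: reduced_def)

lemma reduced_prefix:
  assumes "reduced (xs @ ys)"
  shows "reduced xs"
proof -
  have S: "xs \<in> lists S" "ys \<in> lists S" using assms by (auto simp: reduced_def)
  obtain zs where zs: "reduced zs" "val zs = val xs"
    using reduced_word_exists[of "val xs"] S by auto
  then have "len (val (zs @ ys)) \<le> length (zs @ ys)"
    using S by (intro len_le) (simp add: reduced_def)
  moreover have "val (zs @ ys) = val (xs @ ys)"
    using S zs by (simp add: val_append reduced_def)
  ultimately have "length xs \<le> len (val xs)"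
    using assms zs by (simp add: reduced_def)
  then show ?thesis using S len_le[of xs] by (simp add: reduced_def)
qed

text \<open>
  If \<open>t\<close> is the \<open>i\<close>-th reflection along a word, multiplication by \<open>t\<close> deletes the \<open>i\<close>-th letter.
\<close>
lemma refl_parity_deletion:
  assumes "ss \<in> lists S" "t \<in> carrier W" "refl_parity ss t"
  shows "\<exists>xs a ys. ss = xs @ a # ys \<and> t \<otimes> val ss = val (xs @ ys)"
  using assms
proof (induction ss arbitrary: t)
  case (Cons s ss)
  then have s: "s \<in> S" "ss \<in> lists S" by auto
  show ?case
  proof (cases "t = s")
    case True
    then show ?thesis using s by (intro exI[of _ "[]"] exI[of _ s] exI[of _ ss]) auto
  next
    case False
    then have "refl_parity ss (s \<otimes> t \<otimes> s)" using Cons.prems by auto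
    then obtain xs a ys where ss: "ss = xs @ a # ys"
      and eq: "s \<otimes> t \<otimes> s \<otimes> val ss = val (xs @ ys)"
      using Cons.IH[of "s \<otimes> t \<otimes> s"] s Cons.prems by auto
    have "t \<otimes> val (s # ss) = s \<otimes> (s \<otimes> t \<otimes> s \<otimes> val ss)"
      using s Cons.prems by (simp add: m_assoc)
    also have "\<dots> = val ((s # xs) @ ys)" unfolding eq by simp
    finally show ?thesis unfolding ss by (intro exI[of _ "s # xs"]) auto
  qed
qed simp

text \<open>
  Prefixing \<open>s\<close> to a reduced word of \<open>s w\<close> gives a word of \<open>w\<close> along which \<open>s\<close> occurs an odd number of
  times as a reflection: it occurs in the first place, and not oddly often later on, since
  otherwise deletion would give a word of \<open>w\<close> that is too short.  By invariance \<open>s\<close> then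
  occurs along every word of \<open>w\<close>, and the corresponding letter can be deleted.
\<close>
lemma exchange:
  assumes ss: "reduced ss" and s: "s \<in> S" and less: "len (s \<otimes> val ss) < len (val ss)"
  shows "\<exists>xs a ys. ss = xs @ a # ys \<and> s \<otimes> val ss = val (xs @ ys)"
proof -
  have w: "val ss \<in> carrier W" using ss by (simp add: reduced_def)
  obtain zs where zs: "reduced zs" "val zs = s \<otimes> val ss"
    using reduced_word_exists[of "s \<otimes> val ss"] s w by auto
  have zs_S: "zs \<in> lists S" using zs by (simp add: reduced_def)
  have "\<not> refl_parity zs s"
  proof
    assume "refl_parity zs s"
    then obtain xs a ys where "zs = xs @ a # ys" "s \<otimes> val zs = val (xs @ ys)"
      using refl_parity_deletion[OF zs_S generator_closed[OF s]] by blast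
    then have "len (val ss) < length zs"
      using len_le[of "xs @ ys"] zs zs_S s w by auto
    then show False using zs less by (simp add: reduced_def)
  qed
  then have "refl_parity (s # zs) s" using s by simp
  moreover have "val (s # zs) = val ss" using zs s w by simp
  ultimately have "refl_parity ss s"
    using val_eq_invariants(2)[of "s # zs" ss s] s zs_S ss by (simp add: reduced_def)
  then show ?thesis using refl_parity_deletion[of ss s] ss s by (simp add: reduced_def)
qed

text \<open>
  Take a pair of reduced words of minimal length with equal values on which \<open>F\<close> differs.  By
  minimality they share neither the first nor the last letter.  If \<open>s\<close> begins the second word, the
  exchange condition moves \<open>s\<close> to the front of the first word at the cost of one letter.
  Sharing its first letter with the second word, the result has the same \<open>F\<close>-value as that word; so
  it must not share its last letter with the first word, which means that the deleted letter was the
  last one.  Thus \<open>(x, y)\<close> may be replaced by \<open>(s # butlast x, x)\<close>, and repeating this produces two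
  words that alternate in \<open>r\<close> and \<open>s\<close> throughout, contradicting the hypothesis on alternating words.
\<close>
lemma matsumoto_reduced_words:
  fixes F :: "'a list \<Rightarrow> 'b"
  assumes left: "\<And>s xs ys. \<lbrakk>s \<in> S; xs \<in> lists S; ys \<in> lists S; F xs = F ys\<rbrakk> \<Longrightarrow> F (s # xs) = F (s # ys)"
    and right: "\<And>s xs ys. \<lbrakk>s \<in> S; xs \<in> lists S; ys \<in> lists S; F xs = F ys\<rbrakk> \<Longrightarrow> F (xs @ [s]) = F (ys @ [s])"
    and braid: "\<And>r s k. \<lbrakk>r \<in> S; s \<in> S; reduced (alternating_word r s k);
      reduced (alternating_word s r k); val (alternating_word r s k) = val (alternating_word s r k)\<rbrakk>
      \<Longrightarrow> F (alternating_word r s k) = F (alternating_word s r k)"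
    and "reduced xs" "reduced ys" "val xs = val ys"
  shows "F xs = F ys"
  using assms(4-6)
proof (induction "length xs" arbitrary: xs ys rule: less_induct)
  case less
  define N where "N = length xs"
  define bad where "bad xs ys \<longleftrightarrow> reduced xs \<and> reduced ys \<and> val xs = val ys \<and> length xs = N \<and> F xs \<noteq> F ys"
    for xs ys
  have bad_length: "length ys = N" if "bad xs ys" for xs ys
    using that by (auto simp: bad_def reduced_def)
  have bad_sym: "bad ys xs" if "bad xs ys" for xs ys
    using that bad_length[OF that] by (auto simp: bad_def)
  have bad_hd: False if "bad (s # xs) (s # ys)" for s xs ys
  proof -
    have red: "s \<in> S" "reduced xs" "reduced ys"
      using that reduced_Cons[of s xs] reduced_Cons[of s ys] by (auto simp: bad_def)
    then have "val xs = val ys"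
      using that by (auto simp: bad_def reduced_def)
    then have "F xs = F ys"
      using less.hyps[of xs ys] red that by (auto simp: bad_def N_def[symmetric])
    then show False using left[of s xs ys] red that by (auto simp: bad_def reduced_def)
  qed
  have bad_last: False if "bad (xs @ [s]) (ys @ [s])" for s xs ys
  proof -
    have red: "s \<in> S" "reduced xs" "reduced ys"
      using that reduced_prefix[of xs "[s]"] reduced_prefix[of ys "[s]"]
      by (auto simp: bad_def reduced_def)
    then have "val xs = val ys"
      using that by (auto simp: bad_def reduced_def val_append)
    then have "F xs = F ys"
      using less.hyps[of xs ys] red that by (auto simp: bad_def N_def[symmetric])
    then show False using right[of s xs ys] red that by (auto simp: bad_def reduced_def)
  qed
  have step: "bad (s # butlast xs) xs" if b: "bad xs (s # ys)" for s xs ys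
  proof -
    have red: "reduced xs" "s \<in> S" "reduced ys" "reduced (s # ys)" "val xs = s \<otimes> val ys"
      and lens: "length xs = N" "len (s \<otimes> val ys) = Suc (len (val ys))"
      using b reduced_Cons[of s ys] by (auto simp: bad_def)
    then have sw: "s \<otimes> val xs = val ys" by (simp add: reduced_def)
    then have "len (s \<otimes> val xs) < len (val xs)" using red lens by simp
    from exchange[OF red(1,2) this] obtain as a bs
      where xs: "xs = as @ a # bs" and del: "s \<otimes> val xs = val (as @ bs)" by auto
    let ?z = "s # as @ bs"
    have AS: "as \<in> lists S" "bs \<in> lists S" using red xs by (auto simp: reduced_def)
    have valz: "val ?z = val xs" using del[symmetric] red by (simp add: reduced_def)
    have redz: "reduced ?z"
      using valz red AS xs by (auto simp: reduced_def)
    have "F ?z = F (s # ys)"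
    proof (rule ccontr)
      assume "F ?z \<noteq> F (s # ys)"
      then have "bad ?z (s # ys)"
        using redz red valz b lens xs by (auto simp: bad_def)
      then show False by (rule bad_hd)
    qed
    then have bz: "bad ?z xs" using redz red valz b lens xs by (auto simp: bad_def)
    have "bs = []"
    proof (rule ccontr)
      assume "bs \<noteq> []"
      then obtain cs c where bs: "bs = cs @ [c]" by (meson rev_exhaust)
      with bz have "bad ((s # as @ cs) @ [c]) ((as @ a # cs) @ [c])" using xs by simp
      then show False by (rule bad_last)
    qed
    then show ?thesis using bz xs by (simp add: butlast_append)
  qed
  show ?case
  proof (rule ccontr)
    assume "F xs \<noteq> F ys"
    then have bad0: "bad xs ys" using less.prems by (auto simp: bad_def N_def)
    then have "xs \<noteq> []" "ys \<noteq> []"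
      using bad_length[OF bad0] by (auto simp: bad_def)
    then obtain r xs' s ys' where xs: "xs = r # xs'" and ys: "ys = s # ys'"
      by (meson neq_Nil_conv)
    have rs: "r \<in> S" "s \<in> S" using bad0 xs ys by (auto simp: bad_def reduced_def)
    have N: "N > 0" using xs by (simp add: N_def)
    \<comment> \<open>Every replacement lengthens the alternating prefixes by one; the first word stays one letter
      ahead of the second, because the old first word becomes the new second one.\<close>
    have "\<exists>r \<in> S. \<exists>s \<in> S. \<exists>xs ys. bad xs (s # ys) \<and>
        take (Suc j) xs = take (Suc j) (alternating_word r s N) \<and>
        take j (s # ys) = take j (alternating_word s r N)" for j
    proof (induction j)
      case 0
      have "take 1 xs = take 1 (alternating_word r s N)"
        using N xs by (cases N) auto
      then show ?case using rs bad0 ys by auto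
    next
      case (Suc j)
      then obtain r s xs ys where rs: "r \<in> S" "s \<in> S" and b: "bad xs (s # ys)"
        and t: "take (Suc j) xs = take (Suc j) (alternating_word r s N)" by blast
      have lx: "length xs = N" using b by (simp add: bad_def)
      obtain r' xs' where xs: "xs = r' # xs'" using lx N by (cases xs) auto
      have r': "r' = r" using t xs N by (cases N) auto
      have "take (Suc j) (butlast xs) = take (N - 1) (take (Suc j) xs)"
        using lx by (simp add: butlast_conv_take min.commute)
      also have "\<dots> = take (Suc j) (alternating_word r s (N - 1))"
        unfolding t by (simp add: take_alternating_word min.commute min.left_commute)
      finally have "take (Suc (Suc j)) (s # butlast xs) = take (Suc (Suc j)) (alternating_word s r N)"
        using N by (cases N) auto
      then show ?case using step[OF b] rs t xs r' by blast
    qed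
    from this[of N] obtain r s xs ys where rs: "r \<in> S" "s \<in> S" and b: "bad xs (s # ys)"
      and t: "take (Suc N) xs = take (Suc N) (alternating_word r s N)"
        "take N (s # ys) = take N (alternating_word s r N)" by blast
    have "xs = alternating_word r s N" "s # ys = alternating_word s r N"
      using t b bad_length[OF b] by (auto simp: bad_def)
    then show False using b braid[OF rs, of N] by (auto simp: bad_def)
  qed
qed

end

lemma indet_nonzero [simp]: "indet \<noteq> 0"
  by (simp add: indet_def Zero_fract_def eq_fract)

lemma lookup_scale [simp]: "Poly_Mapping.lookup (scale c x) a = c * Poly_Mapping.lookup x a"
  by (simp add: scale_def Poly_Mapping.map.rep_eq when_def)

lemma lookup_basis_vec: "Poly_Mapping.lookup (basis_vec a) b = (if a = b then 1 else 0)"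
  by (simp add: basis_vec_def lookup_single when_def)

lemma free_space_iff: "x \<in> free_space X \<longleftrightarrow> (\<forall>a. a \<notin> X \<longrightarrow> Poly_Mapping.lookup x a = 0)"
  by (auto simp: free_space_def in_keys_iff)

lemma free_space_closed [simp]:
  "0 \<in> free_space X"
  "x \<in> free_space X \<Longrightarrow> y \<in> free_space X \<Longrightarrow> x + y \<in> free_space X"
  "x \<in> free_space X \<Longrightarrow> y \<in> free_space X \<Longrightarrow> x - y \<in> free_space X"
  "x \<in> free_space X \<Longrightarrow> scale c x \<in> free_space X"
  "basis_vec a \<in> free_space X \<longleftrightarrow> a \<in> X"
  by (auto simp: free_space_iff lookup_add lookup_minus lookup_basis_vec)

lemma free_space_sum [simp]:
  "(\<And>i. i \<in> I \<Longrightarrow> f i \<in> free_space X) \<Longrightarrow> (\<Sum>i\<in>I. f i) \<in> free_space X"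
  by (induction I rule: infinite_finite_induct) auto

lemma scale_simps [simp]:
  "scale c 0 = 0" "scale 0 x = 0" "scale 1 x = x"
  "scale c (scale d x) = scale (c * d) x"
  by (auto intro!: poly_mapping_eqI)

lemma scale_distribs:
  "scale c (x + y) = scale c x + scale c y"
  "scale c (x - y) = scale c x - scale c y"
  "scale (c + d) x = scale c x + scale d x"
  "scale (c - d) x = scale c x - scale d x"
  by (auto intro!: poly_mapping_eqI simp: lookup_add lookup_minus algebra_simps)

lemma scale_cancel: "c \<noteq> 0 \<Longrightarrow> scale c x = scale c y \<longleftrightarrow> x = y"
  by (metis scale_simps(3,4) right_inverse mult.commute)

lemma free_space_induct [consumes 1, case_names zero add scale]:
  assumes "x \<in> free_space X" and "P 0"
    and "\<And>x y. \<lbrakk>x \<in> free_space X; y \<in> free_space X; P x; P y\<rbrakk> \<Longrightarrow> P (x + y)"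
    and "\<And>c a. a \<in> X \<Longrightarrow> P (scale c (basis_vec a))"
  shows "P x"
proof -
  have eq: "x = (\<Sum>a\<in>Poly_Mapping.keys x. scale (Poly_Mapping.lookup x a) (basis_vec a))"
    by (rule poly_mapping_eqI)
      (simp add: lookup_sum lookup_basis_vec in_keys_iff if_distrib cong: if_cong)
  have "P (\<Sum>a\<in>A. scale (c a) (basis_vec a))" if "finite A" "A \<subseteq> X" for A c
    using that
  proof (induction A rule: finite_induct)
    case (insert a A)
    then have "P (scale (c a) (basis_vec a) + (\<Sum>a\<in>A. scale (c a) (basis_vec a)))"
      by (intro assms(3,4)) (auto intro!: free_space_closed(4) free_space_sum)
    with insert show ?case by simp
  qed (simp add: assms(2))
  from this[of "Poly_Mapping.keys x"] show ?thesis
    using assms(1) by (subst eq) (auto simp: free_space_def)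
qed

definition linear_extension :: "('x \<Rightarrow> ('y \<Rightarrow>\<^sub>0 ratfun)) \<Rightarrow> ('x \<Rightarrow>\<^sub>0 ratfun) \<Rightarrow> ('y \<Rightarrow>\<^sub>0 ratfun)" where
  "linear_extension f x = (\<Sum>a\<in>Poly_Mapping.keys x. scale (Poly_Mapping.lookup x a) (f a))"

lemma linear_extension_superset:
  assumes "finite K" "Poly_Mapping.keys x \<subseteq> K"
  shows "linear_extension f x = (\<Sum>a\<in>K. scale (Poly_Mapping.lookup x a) (f a))"
  unfolding linear_extension_def using assms
  by (intro sum.mono_neutral_left) (auto simp: in_keys_iff)

lemma linear_extension_add: "linear_extension f (x + y) = linear_extension f x + linear_extension f y"
proof -
  let ?K = "Poly_Mapping.keys x \<union> Poly_Mapping.keys y"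
  have "Poly_Mapping.keys (x + y) \<subseteq> ?K" by (rule Poly_Mapping.keys_add)
  then show ?thesis
    by (simp add: linear_extension_superset[of ?K] lookup_add scale_distribs sum.distrib)
qed

lemma scale_sum: "scale c (sum g A) = (\<Sum>a\<in>A. scale c (g a))"
  by (induction A rule: infinite_finite_induct) (auto simp: scale_distribs)

lemma linear_extension_scale: "linear_extension f (scale c x) = scale c (linear_extension f x)"
proof -
  have "Poly_Mapping.keys (scale c x) \<subseteq> Poly_Mapping.keys x" by (auto simp: in_keys_iff)
  then show ?thesis
    by (simp add: linear_extension_superset[of "Poly_Mapping.keys x"] scale_sum)
qed

lemma linear_extension_basis_vec [simp]: "linear_extension f (basis_vec a) = f a"
  by (simp add: linear_extension_def basis_vec_def)

lemma linear_extension_closed: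
  "x \<in> free_space X \<Longrightarrow> (\<And>a. a \<in> X \<Longrightarrow> f a \<in> free_space Y) \<Longrightarrow> linear_extension f x \<in> free_space Y"
  unfolding linear_extension_def free_space_def[of X] by (auto intro!: free_space_sum)

lemma linear_extension_zero [simp]: "linear_extension f 0 = 0"
  by (simp add: linear_extension_def)

lemma linear_extension_cong:
  "h \<in> free_space X \<Longrightarrow> (\<And>a. a \<in> X \<Longrightarrow> f a = g a) \<Longrightarrow> linear_extension f h = linear_extension g h"
  unfolding linear_extension_def free_space_def by (intro sum.cong) auto

lemma linear_extension_fun_add:
  "linear_extension (\<lambda>a. f a + g a) h = linear_extension f h + linear_extension g h"
  by (simp add: linear_extension_def scale_distribs sum.distrib)

lemma linear_extension_fun_scale:
  "linear_extension (\<lambda>a. scale c (f a)) h = scale c (linear_extension f h)"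
  by (simp add: linear_extension_def scale_sum mult.commute)

section \<open>The operators of a labeled digraph\<close>

definition arc_at :: "('v, 'e, 's) labeled_digraph \<Rightarrow> 's \<Rightarrow> 'v \<Rightarrow> 'e" where
  "arc_at \<Gamma> s \<alpha> = (THE e. incident_arc \<Gamma> s \<alpha> e)"

definition mate :: "('v, 'e, 's) labeled_digraph \<Rightarrow> 's \<Rightarrow> 'v \<Rightarrow> 'v" where
  "mate \<Gamma> s \<alpha> =
    (if tail \<Gamma> (arc_at \<Gamma> s \<alpha>) = \<alpha> then head \<Gamma> (arc_at \<Gamma> s \<alpha>) else tail \<Gamma> (arc_at \<Gamma> s \<alpha>))"

text \<open>
  The matrix of \<open>\<tau>\<^sub>s\<close> in the basis of vertices has at most two nonzero entries in the column of
  \<open>\<alpha>\<close>: the diagonal entry \<open>stay\<close>, and the entry \<open>move\<close> in the row of the other end of the arc.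
\<close>
definition stay :: "('v, 'e, 's) labeled_digraph \<Rightarrow> 's \<Rightarrow> 'v \<Rightarrow> ratfun" where
  "stay \<Gamma> s \<alpha> =
    (if solid \<Gamma> (arc_at \<Gamma> s \<alpha>)
     then if tail \<Gamma> (arc_at \<Gamma> s \<alpha>) = \<alpha> then 0 else indet\<^sup>2 - 1
     else if tail \<Gamma> (arc_at \<Gamma> s \<alpha>) = \<alpha> then indet else indet\<^sup>2 - indet - 1)"

definition move :: "('v, 'e, 's) labeled_digraph \<Rightarrow> 's \<Rightarrow> 'v \<Rightarrow> ratfun" where
  "move \<Gamma> s \<alpha> =
    (if solid \<Gamma> (arc_at \<Gamma> s \<alpha>)
     then if tail \<Gamma> (arc_at \<Gamma> s \<alpha>) = \<alpha> then 1 else indet\<^sup>2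
     else if tail \<Gamma> (arc_at \<Gamma> s \<alpha>) = \<alpha> then indet + 1 else indet\<^sup>2 - indet)"

lemma tau_vertex_eq:
  "tau_vertex \<Gamma> s \<alpha> = scale (stay \<Gamma> s \<alpha>) (basis_vec \<alpha>) + scale (move \<Gamma> s \<alpha>) (basis_vec (mate \<Gamma> s \<alpha>))"
  by (auto simp: tau_vertex_def stay_def move_def mate_def arc_at_def Let_def)

lemma tau_eq_linear_extension:
  "x \<in> free_space (verts \<Gamma>) \<Longrightarrow> tau \<Gamma> s x = linear_extension (tau_vertex \<Gamma> s) x"
  by (simp add: tau_def linear_extension_def)

locale labeled_digraph_on =
  fixes S :: "'s set" and \<Gamma> :: "('v, 'e, 's) labeled_digraph"
  assumes labeled: "S_labeled_digraph S \<Gamma>"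
begin

abbreviation V :: "('v \<Rightarrow>\<^sub>0 ratfun) set" where
  "V \<equiv> free_space (verts \<Gamma>)"

lemma arc_ends:
  assumes "e \<in> arcs \<Gamma>"
  shows "tail \<Gamma> e \<in> verts \<Gamma>" "head \<Gamma> e \<in> verts \<Gamma>" "tail \<Gamma> e \<noteq> head \<Gamma> e"
proof -
  interpret loopfree_digraph "pre_digraph.truncate \<Gamma>"
    using labeled by (simp add: S_labeled_digraph_def)
  show "tail \<Gamma> e \<in> verts \<Gamma>" "head \<Gamma> e \<in> verts \<Gamma>" "tail \<Gamma> e \<noteq> head \<Gamma> e"
    using assms tail_in_verts[of e] head_in_verts[of e] no_loops[of e]
    by (auto simp: pre_digraph.truncate_def)
qed

lemma arc_at_eqI:
  "s \<in> S \<Longrightarrow> \<alpha> \<in> verts \<Gamma> \<Longrightarrow> incident_arc \<Gamma> s \<alpha> e \<Longrightarrow> arc_at \<Gamma> s \<alpha> = e"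
  using labeled unfolding S_labeled_digraph_def arc_at_def by (metis the1_equality)

lemma incident_arc_at:
  "s \<in> S \<Longrightarrow> \<alpha> \<in> verts \<Gamma> \<Longrightarrow> incident_arc \<Gamma> s \<alpha> (arc_at \<Gamma> s \<alpha>)"
  using labeled unfolding S_labeled_digraph_def arc_at_def by (metis theI')

lemma mate_props:
  assumes "s \<in> S" "\<alpha> \<in> verts \<Gamma>"
  shows mate_verts: "mate \<Gamma> s \<alpha> \<in> verts \<Gamma>"
    and mate_mate: "mate \<Gamma> s (mate \<Gamma> s \<alpha>) = \<alpha>"
    and mate_neq: "mate \<Gamma> s \<alpha> \<noteq> \<alpha>"
    and stay_mate: "stay \<Gamma> s (mate \<Gamma> s \<alpha>) = indet\<^sup>2 - 1 - stay \<Gamma> s \<alpha>"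
    and stay_move: "stay \<Gamma> s \<alpha> * stay \<Gamma> s \<alpha> + move \<Gamma> s \<alpha> * move \<Gamma> s (mate \<Gamma> s \<alpha>)
      = (indet\<^sup>2 - 1) * stay \<Gamma> s \<alpha> + indet\<^sup>2"
proof -
  let ?e = "arc_at \<Gamma> s \<alpha>"
  have e: "?e \<in> arcs \<Gamma>" "arc_label \<Gamma> ?e = s" "tail \<Gamma> ?e = \<alpha> \<or> head \<Gamma> ?e = \<alpha>"
    using incident_arc_at[OF assms] by (auto simp: incident_arc_def)
  note ends = arc_ends[OF e(1)]
  show m: "mate \<Gamma> s \<alpha> \<in> verts \<Gamma>" "mate \<Gamma> s \<alpha> \<noteq> \<alpha>"
    using ends e by (auto simp: mate_def)
  have "incident_arc \<Gamma> s (mate \<Gamma> s \<alpha>) ?e" using e by (auto simp: incident_arc_def mate_def)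
  with assms m have arc: "arc_at \<Gamma> s (mate \<Gamma> s \<alpha>) = ?e" by (intro arc_at_eqI) auto
  show "mate \<Gamma> s (mate \<Gamma> s \<alpha>) = \<alpha>"
    unfolding mate_def[of \<Gamma> s "mate \<Gamma> s \<alpha>"] arc using e ends by (auto simp: mate_def)
  have t: "tail \<Gamma> ?e = mate \<Gamma> s \<alpha> \<longleftrightarrow> tail \<Gamma> ?e \<noteq> \<alpha>"
    using e ends by (auto simp: mate_def)
  show "stay \<Gamma> s (mate \<Gamma> s \<alpha>) = indet\<^sup>2 - 1 - stay \<Gamma> s \<alpha>"
    unfolding stay_def arc t by auto
  show "stay \<Gamma> s \<alpha> * stay \<Gamma> s \<alpha> + move \<Gamma> s \<alpha> * move \<Gamma> s (mate \<Gamma> s \<alpha>)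
      = (indet\<^sup>2 - 1) * stay \<Gamma> s \<alpha> + indet\<^sup>2"
    unfolding stay_def move_def arc t by (auto simp: algebra_simps power2_eq_square)
qed

lemma tau_vertex_closed:
  "s \<in> S \<Longrightarrow> \<alpha> \<in> verts \<Gamma> \<Longrightarrow> tau_vertex \<Gamma> s \<alpha> \<in> V"
  by (simp add: tau_vertex_eq mate_verts)

lemma tau_closed [simp]: "s \<in> S \<Longrightarrow> x \<in> V \<Longrightarrow> tau \<Gamma> s x \<in> V"
  using tau_vertex_closed linear_extension_closed
  by (metis tau_eq_linear_extension)

lemma tau_linear:
  "x \<in> V \<Longrightarrow> y \<in> V \<Longrightarrow> tau \<Gamma> s (x + y) = tau \<Gamma> s x + tau \<Gamma> s y"
  "x \<in> V \<Longrightarrow> tau \<Gamma> s (scale c x) = scale c (tau \<Gamma> s x)"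
  by (simp_all add: tau_eq_linear_extension linear_extension_add linear_extension_scale)

lemma lookup_tau:
  assumes s: "s \<in> S" and x: "x \<in> V" and b: "\<beta> \<in> verts \<Gamma>"
  shows "Poly_Mapping.lookup (tau \<Gamma> s x) \<beta> =
    stay \<Gamma> s \<beta> * Poly_Mapping.lookup x \<beta>
    + move \<Gamma> s (mate \<Gamma> s \<beta>) * Poly_Mapping.lookup x (mate \<Gamma> s \<beta>)"
  using x
proof (induction x rule: free_space_induct)
  case zero
  then show ?case by (simp add: tau_eq_linear_extension linear_extension_def)
next
  case (add x y)
  then show ?case by (simp add: tau_linear lookup_add algebra_simps)
next
  case (scale c \<alpha>)
  have "mate \<Gamma> s \<alpha> = \<beta> \<longleftrightarrow> \<alpha> = mate \<Gamma> s \<beta>" "mate \<Gamma> s \<beta> \<noteq> \<beta>"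
    using s b scale mate_mate mate_neq by metis+
  then show ?case using scale
    by (auto simp: tau_eq_linear_extension linear_extension_scale tau_vertex_eq lookup_add lookup_basis_vec)
qed

lemma quadratic_relation:
  assumes "s \<in> S" "x \<in> V"
  shows "tau \<Gamma> s (tau \<Gamma> s x) = scale (indet\<^sup>2) x + scale (indet\<^sup>2 - 1) (tau \<Gamma> s x)"
proof (rule poly_mapping_eqI)
  fix \<beta>
  show "Poly_Mapping.lookup (tau \<Gamma> s (tau \<Gamma> s x)) \<beta> =
      Poly_Mapping.lookup (scale (indet\<^sup>2) x + scale (indet\<^sup>2 - 1) (tau \<Gamma> s x)) \<beta>"
  proof (cases "\<beta> \<in> verts \<Gamma>")
    case True
    have q: "move \<Gamma> s \<beta> * move \<Gamma> s (mate \<Gamma> s \<beta>) =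
        (indet\<^sup>2 - 1) * stay \<Gamma> s \<beta> + indet\<^sup>2 - stay \<Gamma> s \<beta> * stay \<Gamma> s \<beta>"
      using stay_move[OF assms(1) True] by (simp add: algebra_simps)
    have "p * (p * x + m' * y) + m' * ((i - p) * y + m * x) = (p * p + m * m') * x + i * (m' * y)"
      for p m m' x y i :: ratfun by (simp add: algebra_simps)
    then show ?thesis
      using assms True
      by (simp add: lookup_tau lookup_add mate_verts mate_mate stay_mate q) (simp add: algebra_simps)
  next
    case False
    then have "Poly_Mapping.lookup z \<beta> = 0" if "z \<in> V" for z using that by (auto simp: free_space_iff)
    then show ?thesis using assms by simp
  qed
qed

lemma tau_word_closed [simp]: "xs \<in> lists S \<Longrightarrow> x \<in> V \<Longrightarrow> foldr (tau \<Gamma>) xs x \<in> V"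
  by (induction xs) auto

lemma tau_word_linear:
  assumes "xs \<in> lists S" "x \<in> V"
  shows "y \<in> V \<Longrightarrow> foldr (tau \<Gamma>) xs (x + y) = foldr (tau \<Gamma>) xs x + foldr (tau \<Gamma>) xs y"
    and "foldr (tau \<Gamma>) xs (scale c x) = scale c (foldr (tau \<Gamma>) xs x)"
  using assms by (induction xs) (auto simp: tau_linear)

text \<open>
  Up to the scalar \<open>- u\<^sup>2\<close>, the inverse of \<open>\<tau>\<^sub>s\<close>.
\<close>
definition theta :: "'s \<Rightarrow> ('v \<Rightarrow>\<^sub>0 ratfun) \<Rightarrow> ('v \<Rightarrow>\<^sub>0 ratfun)" where
  "theta s x = scale (indet\<^sup>2 - 1) x - tau \<Gamma> s x"

lemma theta_closed [simp]: "s \<in> S \<Longrightarrow> x \<in> V \<Longrightarrow> theta s x \<in> V"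
  by (simp add: theta_def)

lemma tau_diff: "x \<in> V \<Longrightarrow> y \<in> V \<Longrightarrow> tau \<Gamma> s (x - y) = tau \<Gamma> s x - tau \<Gamma> s y"
  using tau_linear(1)[of "x - y" y s] by (simp add: algebra_simps)

lemma theta_scale: "x \<in> V \<Longrightarrow> theta s (scale c x) = scale c (theta s x)"
  by (simp add: theta_def tau_linear scale_distribs algebra_simps)

lemma tau_theta:
  assumes "s \<in> S" "x \<in> V"
  shows "tau \<Gamma> s (theta s x) = scale (- (indet\<^sup>2)) x" "theta s (tau \<Gamma> s x) = scale (- (indet\<^sup>2)) x"
proof -
  have "scale (- c) x = 0 - scale c x" for c
    by (auto intro!: poly_mapping_eqI simp: lookup_minus)
  then show "tau \<Gamma> s (theta s x) = scale (- (indet\<^sup>2)) x" "theta s (tau \<Gamma> s x) = scale (- (indet\<^sup>2)) x"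
    using assms by (simp_all add: theta_def tau_diff tau_linear quadratic_relation)
qed

lemma theta_word_closed [simp]: "xs \<in> lists S \<Longrightarrow> x \<in> V \<Longrightarrow> foldr theta xs x \<in> V"
  by (induction xs) auto

lemma theta_word_scale:
  "xs \<in> lists S \<Longrightarrow> x \<in> V \<Longrightarrow> foldr theta xs (scale c x) = scale c (foldr theta xs x)"
  by (induction xs) (auto simp: theta_scale)

lemma tau_theta_word:
  assumes "xs \<in> lists S" "x \<in> V"
  shows "foldr (tau \<Gamma>) xs (foldr theta (rev xs) x) = scale ((- (indet\<^sup>2)) ^ length xs) x"
    and "foldr theta (rev xs) (foldr (tau \<Gamma>) xs x) = scale ((- (indet\<^sup>2)) ^ length xs) x"
proof -
  define k where "k = - (indet\<^sup>2)"
  have tt: "tau \<Gamma> s (theta s z) = scale k z" "theta s (tau \<Gamma> s z) = scale k z"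
    if "s \<in> S" "z \<in> V" for s z using tau_theta that by (simp_all add: k_def)
  have "foldr (tau \<Gamma>) xs (foldr theta (rev xs) x) = scale (k ^ length xs) x"
    using assms
  proof (induction xs arbitrary: x)
    case (Cons s xs)
    then have s: "s \<in> S" "xs \<in> lists S" by auto
    then show ?case using Cons.IH[of "theta s x"] Cons.prems by (simp add: tau_linear tt mult.commute)
  qed simp
  moreover have "foldr theta (rev xs) (foldr (tau \<Gamma>) xs x) = scale (k ^ length xs) x"
    using assms
  proof (induction xs)
    case (Cons s xs)
    then have s: "s \<in> S" "xs \<in> lists S" "rev xs \<in> lists S" by auto
    then have "foldr theta (rev xs) (scale k (foldr (tau \<Gamma>) xs x))
        = scale k (foldr theta (rev xs) (foldr (tau \<Gamma>) xs x))"
      using Cons.prems by (intro theta_word_scale) auto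
    then show ?case using s Cons by (simp add: tt)
  qed simp
  ultimately show "foldr (tau \<Gamma>) xs (foldr theta (rev xs) x) = scale ((- (indet\<^sup>2)) ^ length xs) x"
    and "foldr theta (rev xs) (foldr (tau \<Gamma>) xs x) = scale ((- (indet\<^sup>2)) ^ length xs) x"
    by (simp_all add: k_def)
qed

text \<open>
  Inverting both sides of an equation reverses the order of the factors; since the two words have equal
  length, the scalars \<open>- u\<^sup>2\<close> by which \<open>\<theta>\<close> differs from the inverse cancel.
\<close>
lemma theta_word_eq:
  assumes "xs \<in> lists S" "ys \<in> lists S" "length xs = length ys"
    and eq: "\<And>x. x \<in> V \<Longrightarrow> foldr (tau \<Gamma>) xs x = foldr (tau \<Gamma>) ys x" and y: "y \<in> V"
  shows "foldr theta (rev xs) y = foldr theta (rev ys) y"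
proof -
  let ?k = "(- (indet\<^sup>2)) ^ length xs"
  have rev: "rev xs \<in> lists S" "rev ys \<in> lists S" using assms by auto
  have z: "foldr theta (rev ys) y \<in> V" using rev y theta_word_closed by blast
  have "scale ?k (foldr theta (rev xs) y) = foldr theta (rev xs) (scale ?k y)"
    using theta_word_scale rev y by metis
  also have "scale ?k y = foldr (tau \<Gamma>) xs (foldr theta (rev ys) y)"
    using tau_theta_word(1)[OF assms(2) y] assms(3) eq[OF z] by simp
  also have "foldr theta (rev xs) \<dots> = scale ?k (foldr theta (rev ys) y)"
    using tau_theta_word(2)[OF assms(1) z] .
  finally show ?thesis by (subst (asm) scale_cancel) auto
qed

end

section \<open>Two-colorings of the arcs with two labels\<close>

text \<open>
  A closed walk of odd length that alternates between the two matchings \<open>\<rho>\<close> and \<open>\<sigma>\<close> starts and ends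
  with the same matching.  Folding it up from its ends, two steps on either side at a time, leaves
  a single matching edge with equal ends, which is impossible.
\<close>
lemma no_odd_closed_walk:
  fixes \<rho> \<sigma> :: "'v \<Rightarrow> 'v"
  assumes \<rho>: "\<And>a. a \<in> A \<Longrightarrow> \<rho> a \<in> A \<and> \<rho> (\<rho> a) = a \<and> \<rho> a \<noteq> a"
    and \<sigma>: "\<And>a. a \<in> A \<Longrightarrow> \<sigma> a \<in> A \<and> \<sigma> (\<sigma> a) = a \<and> \<sigma> a \<noteq> a"
    and "a \<in> A"
  shows "((\<rho> \<circ> \<sigma>) ^^ k) a \<noteq> \<rho> a"
  using \<open>a \<in> A\<close>
proof (induction k arbitrary: a rule: less_induct)
  case (less k)
  consider "k = 0" | "k = 1" | j where "k = Suc (Suc j)" by (metis One_nat_def not0_implies_Suc)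
  then show ?case
  proof cases
    case 1
    then show ?thesis using less.prems \<rho>[of a] by auto
  next
    case 2
    have "\<rho> (\<rho> (\<sigma> a)) \<noteq> \<rho> (\<rho> a)" using less.prems \<rho> \<sigma> by simp
    with 2 show ?thesis by auto
  next
    case (3 j)
    let ?d = "\<rho> (\<sigma> a)"
    have pow_closed: "((\<rho> \<circ> \<sigma>) ^^ i) b \<in> A" if "b \<in> A" for i b
      using that \<rho> \<sigma> by (induction i) auto
    have d: "?d \<in> A" and z: "((\<rho> \<circ> \<sigma>) ^^ j) ?d \<in> A"
      using less.prems \<rho> \<sigma> pow_closed by auto
    have "((\<rho> \<circ> \<sigma>) ^^ k) a = \<rho> (\<sigma> (((\<rho> \<circ> \<sigma>) ^^ j) ?d))"
      using 3 funpow_swap1[of "\<rho> \<circ> \<sigma>" j a] by simp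
    moreover have "((\<rho> \<circ> \<sigma>) ^^ j) ?d \<noteq> \<rho> ?d" by (rule less.IH[OF _ d]) (simp add: 3)
    moreover have "\<rho> ?d = \<sigma> a" using \<rho> \<sigma> less.prems by simp
    moreover have "\<sigma> (\<rho> (\<rho> (\<sigma> z))) = z" if "z \<in> A" for z using that \<rho> \<sigma> by simp
    ultimately show ?thesis using z \<rho>[OF less.prems] by metis
  qed
qed

text \<open>
  The vertices at even distance along alternating walks form a class; each component
  consists of the classes of \<open>a\<close> and of \<open>\<rho> a\<close>, which differ because there is no odd closed walk.
  Choosing one of the two classes in every component gives the coloring.
\<close>
lemma two_coloring_of_two_matchings:
  fixes \<rho> \<sigma> :: "'v \<Rightarrow> 'v"
  assumes \<rho>: "\<And>a. a \<in> A \<Longrightarrow> \<rho> a \<in> A \<and> \<rho> (\<rho> a) = a \<and> \<rho> a \<noteq> a"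
    and \<sigma>: "\<And>a. a \<in> A \<Longrightarrow> \<sigma> a \<in> A \<and> \<sigma> (\<sigma> a) = a \<and> \<sigma> a \<noteq> a"
  shows "\<exists>c :: 'v \<Rightarrow> bool. \<forall>a\<in>A. c (\<rho> a) = (\<not> c a) \<and> c (\<sigma> a) = (\<not> c a)"
proof -
  define step where "step a b \<longleftrightarrow> a \<in> A \<and> (b = \<rho> (\<sigma> a) \<or> b = \<sigma> (\<rho> a))" for a b
  define even_walk where "even_walk = step\<^sup>*\<^sup>*"
  define part where "part a = {b. even_walk a b}" for a
  have step_sym: "step b a" if "step a b" for a b using that \<rho> \<sigma> by (auto simp: step_def)
  have walk_sym: "even_walk b a" if "even_walk a b" for a b
    using that unfolding even_walk_def
    by (induction rule: rtranclp_induct) (auto intro: converse_rtranclp_into_rtranclp step_sym)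
  have part_eq: "part a = part b" if "even_walk a b" for a b
    using that walk_sym[OF that] unfolding part_def even_walk_def by (auto intro: rtranclp_trans)
  have walk_A: "b \<in> A" if "even_walk a b" "a \<in> A" for a b
    using that unfolding even_walk_def
    by (induction rule: rtranclp_induct) (use \<rho> \<sigma> in \<open>auto simp: step_def\<close>)
  have pow: "\<exists>k. ((\<rho> \<circ> \<sigma>) ^^ k) a = b \<or> ((\<rho> \<circ> \<sigma>) ^^ k) b = a"
    if "even_walk a b" "a \<in> A" for a b
    using that(1) unfolding even_walk_def
  proof (induction rule: rtranclp_induct)
    case base
    then show ?case by (intro exI[of _ 0]) auto
  next
    case (step b c)
    let ?f = "\<rho> \<circ> \<sigma>"
    have b: "b \<in> A" using step.hyps by (simp add: step_def)
    have c: "c \<in> A" using step.hyps \<rho> \<sigma> by (auto simp: step_def)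
    have closed: "(?f ^^ i) z \<in> A" if "z \<in> A" for i z
      using that \<rho> \<sigma> by (induction i) auto
    have inj: "y = z" if "?f y = ?f z" "y \<in> A" "z \<in> A" for y z
      using that \<rho> \<sigma> by (metis comp_apply)
    have "?f b = c \<or> ?f c = b" using step.hyps \<rho> \<sigma> by (auto simp: step_def)
    moreover obtain k where "(?f ^^ k) a = b \<or> (?f ^^ k) b = a" using step.IH by blast
    ultimately consider "(?f ^^ Suc k) a = c" | "?f c = b" "(?f ^^ k) a = b"
      | "?f b = c" "(?f ^^ k) b = a" | "(?f ^^ Suc k) c = a"
      by (metis comp_apply funpow.simps(2) funpow_Suc_right)
    then show ?case
    proof cases
      case 2
      show ?thesis
      proof (cases k)
        case 0
        then show ?thesis using 2 by (intro exI[of _ 1]) auto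
      next
        case (Suc j)
        then have "(?f ^^ j) a = c" using 2 inj[of c "(?f ^^ j) a"] closed c \<open>a \<in> A\<close> by auto
        then show ?thesis by blast
      qed
    next
      case 3
      show ?thesis
      proof (cases k)
        case 0
        then show ?thesis using 3 by (intro exI[of _ 1]) auto
      next
        case (Suc j)
        then have "(?f ^^ j) c = a" using 3 by (metis comp_apply funpow_Suc_right)
        then show ?thesis by blast
      qed
    qed blast+
  qed
  have neq: "part (\<rho> a) \<noteq> part a" if a: "a \<in> A" for a
  proof
    assume "part (\<rho> a) = part a"
    then have "even_walk a (\<rho> a)" by (auto simp: part_def even_walk_def)
    then obtain k where "((\<rho> \<circ> \<sigma>) ^^ k) a = \<rho> a \<or> ((\<rho> \<circ> \<sigma>) ^^ k) (\<rho> a) = \<rho> (\<rho> a)"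
      using pow a \<rho> by metis
    then show False
      using no_odd_closed_walk[OF \<rho> \<sigma>] a \<rho> by metis
  qed
  have part_mate: "part (\<sigma> a) = part (\<rho> a)" "part (\<rho> (\<sigma> a)) = part a" "part (\<rho> (\<rho> a)) = part a"
    if a: "a \<in> A" for a
  proof -
    have "step (\<sigma> a) (\<rho> a)" "step a (\<rho> (\<sigma> a))" using a \<rho> \<sigma> by (auto simp: step_def)
    then show "part (\<sigma> a) = part (\<rho> a)" "part (\<rho> (\<sigma> a)) = part a" "part (\<rho> (\<rho> a)) = part a"
      using part_eq a \<rho> by (auto simp: even_walk_def)
  qed
  define c where "c a \<longleftrightarrow> (SOME X. X \<in> {part a, part (\<rho> a)}) = part a" for a
  have "c (\<rho> a) = (\<not> c a) \<and> c (\<sigma> a) = (\<not> c a)" if a: "a \<in> A" for a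
  proof -
    have "(SOME X. X \<in> {part a, part (\<rho> a)}) \<in> {part a, part (\<rho> a)}"
      by (rule someI[of _ "part a"]) simp
    moreover have "{part (\<rho> a), part a} = {part a, part (\<rho> a)}" by auto
    ultimately show ?thesis
      unfolding c_def part_mate[OF a] using neq[OF a] by auto
  qed
  then show ?thesis by blast
qed

section \<open>Reversing all arcs\<close>

lemma rev_digraph_simps [simp]:
  "verts (rev_digraph \<Gamma>) = verts \<Gamma>" "arcs (rev_digraph \<Gamma>) = arcs \<Gamma>"
  "tail (rev_digraph \<Gamma>) = head \<Gamma>" "head (rev_digraph \<Gamma>) = tail \<Gamma>"
  "solid (rev_digraph \<Gamma>) = solid \<Gamma>" "arc_label (rev_digraph \<Gamma>) = arc_label \<Gamma>"
  "rev_digraph (rev_digraph \<Gamma>) = \<Gamma>"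
  by (simp_all add: rev_digraph_def)

lemma incident_arc_rev [simp]: "incident_arc (rev_digraph \<Gamma>) = incident_arc \<Gamma>"
  by (auto simp: incident_arc_def fun_eq_iff)

lemma arc_at_rev [simp]: "arc_at (rev_digraph \<Gamma>) = arc_at \<Gamma>"
  by (simp add: arc_at_def fun_eq_iff)

text \<open>
  The bilinear form in which the vertices are orthogonal and \<open>a\<close> has square length \<open>c a\<close>.
\<close>
definition pairing :: "('v \<Rightarrow> ratfun) \<Rightarrow> ('v \<Rightarrow>\<^sub>0 ratfun) \<Rightarrow> ('v \<Rightarrow>\<^sub>0 ratfun) \<Rightarrow> ratfun" where
  "pairing c x y =
    (\<Sum>a\<in>Poly_Mapping.keys x. c a * Poly_Mapping.lookup x a * Poly_Mapping.lookup y a)"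

lemma pairing_superset:
  assumes "finite K" "Poly_Mapping.keys x \<subseteq> K \<or> Poly_Mapping.keys y \<subseteq> K"
  shows "pairing c x y = (\<Sum>a\<in>K. c a * Poly_Mapping.lookup x a * Poly_Mapping.lookup y a)"
  unfolding pairing_def using assms
  by (intro sum.mono_neutral_cong) (auto simp: in_keys_iff)

context labeled_digraph_on
begin

lemma labeled_rev: "S_labeled_digraph S (rev_digraph \<Gamma>)"
proof -
  have "loopfree_digraph (pre_digraph.truncate (rev_digraph \<Gamma>))"
    using arc_ends by unfold_locales (auto simp: pre_digraph.truncate_def dest: not_sym)
  then show ?thesis using labeled by (simp add: S_labeled_digraph_def)
qed

lemma mate_rev:
  assumes "s \<in> S" "\<alpha> \<in> verts \<Gamma>"
  shows "mate (rev_digraph \<Gamma>) s \<alpha> = mate \<Gamma> s \<alpha>"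
    and "stay (rev_digraph \<Gamma>) s \<alpha> = indet\<^sup>2 - 1 - stay \<Gamma> s \<alpha>"
    and "move (rev_digraph \<Gamma>) s \<alpha> = move \<Gamma> s (mate \<Gamma> s \<alpha>)"
proof -
  let ?e = "arc_at \<Gamma> s \<alpha>"
  have e: "?e \<in> arcs \<Gamma>" "arc_label \<Gamma> ?e = s" "tail \<Gamma> ?e = \<alpha> \<or> head \<Gamma> ?e = \<alpha>"
    using incident_arc_at[OF assms] by (auto simp: incident_arc_def)
  note ends = arc_ends[OF e(1)]
  show "mate (rev_digraph \<Gamma>) s \<alpha> = mate \<Gamma> s \<alpha>"
    and "stay (rev_digraph \<Gamma>) s \<alpha> = indet\<^sup>2 - 1 - stay \<Gamma> s \<alpha>"
    using e ends by (auto simp: mate_def stay_def)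
  have "incident_arc \<Gamma> s (mate \<Gamma> s \<alpha>) ?e" using e by (auto simp: incident_arc_def mate_def)
  then have arc: "arc_at \<Gamma> s (mate \<Gamma> s \<alpha>) = ?e"
    using assms mate_verts by (intro arc_at_eqI) auto
  have "tail \<Gamma> ?e = mate \<Gamma> s \<alpha> \<longleftrightarrow> tail \<Gamma> ?e \<noteq> \<alpha>" "head \<Gamma> ?e = \<alpha> \<longleftrightarrow> tail \<Gamma> ?e \<noteq> \<alpha>"
    using e ends by (auto simp: mate_def)
  then show "move (rev_digraph \<Gamma>) s \<alpha> = move \<Gamma> s (mate \<Gamma> s \<alpha>)"
    unfolding move_def arc by auto
qed

text \<open>
  The diagonal of \<open>\<tau>'\<^sub>s\<close> is that of \<open>\<theta>\<^sub>s\<close>, while an off-diagonal entry of \<open>\<tau>'\<^sub>s\<close> is the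
  negative of the transposed entry of \<open>\<theta>\<^sub>s\<close>; this sign is compensated by the change of \<open>c\<close> along the arc.
\<close>
lemma pairing_tau_rev:
  assumes s: "s \<in> S" and x: "x \<in> V" and y: "y \<in> V"
    and c: "\<And>a. a \<in> verts \<Gamma> \<Longrightarrow> c (mate \<Gamma> s a) = - c a"
  shows "pairing c (tau (rev_digraph \<Gamma>) s x) y = pairing c x (theta s y)"
proof -
  interpret rev: labeled_digraph_on S "rev_digraph \<Gamma>"
    by unfold_locales (rule labeled_rev)
  let ?m = "mate \<Gamma> s"
  let ?X = "Poly_Mapping.lookup x" and ?Y = "Poly_Mapping.lookup y"
  let ?L = "Poly_Mapping.keys x \<union> Poly_Mapping.keys y"
  \<comment> \<open>Both forms are sums over a finite set of vertices that is closed under \<open>?m\<close>, so that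
    the off-diagonal terms can be reindexed by \<open>?m\<close>.\<close>
  define K where "K = ?L \<union> ?m ` ?L"
  have L: "?L \<subseteq> verts \<Gamma>" using x y by (auto simp: free_space_def)
  then have K: "finite K" "K \<subseteq> verts \<Gamma>" "Poly_Mapping.keys x \<subseteq> K" "Poly_Mapping.keys y \<subseteq> K"
    using mate_verts[OF s] by (auto simp: K_def)
  have mm: "?m (?m a) = a" if "a \<in> K" for a using that K(2) mate_mate[OF s] by auto
  have mK: "?m a \<in> K" if "a \<in> K" for a using that mm L mate_mate[OF s] by (auto simp: K_def)
  have bij: "bij_betw ?m K K"
    by (rule bij_betw_byWitness[where f' = ?m]) (use mm mK in auto)
  have left: "Poly_Mapping.lookup (tau (rev_digraph \<Gamma>) s x) a =
      (indet\<^sup>2 - 1 - stay \<Gamma> s a) * ?X a + move \<Gamma> s a * ?X (?m a)" if "a \<in> K" for a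
    using that K s x mate_verts[OF s] mate_mate[OF s]
    by (subst rev.lookup_tau) (auto simp: mate_rev)
  have right: "Poly_Mapping.lookup (theta s y) a =
      (indet\<^sup>2 - 1 - stay \<Gamma> s a) * ?Y a - move \<Gamma> s (?m a) * ?Y (?m a)" if "a \<in> K" for a
    using that K s y by (auto simp: theta_def lookup_minus lookup_tau algebra_simps)
  have "(\<Sum>a\<in>K. c a * (move \<Gamma> s a * ?X (?m a)) * ?Y a)
      = (\<Sum>a\<in>K. c (?m a) * (move \<Gamma> s (?m a) * ?X (?m (?m a))) * ?Y (?m a))"
    using sum.reindex_bij_betw[OF bij, of "\<lambda>a. c a * (move \<Gamma> s a * ?X (?m a)) * ?Y a"] by simp
  also have "\<dots> = (\<Sum>a\<in>K. c a * ?X a * - (move \<Gamma> s (?m a) * ?Y (?m a)))"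
    using mm c K(2) by (intro sum.cong) auto
  finally have swap: "(\<Sum>a\<in>K. c a * (move \<Gamma> s a * ?X (?m a)) * ?Y a)
      = (\<Sum>a\<in>K. c a * ?X a * - (move \<Gamma> s (?m a) * ?Y (?m a)))" .
  have "pairing c (tau (rev_digraph \<Gamma>) s x) y =
      (\<Sum>a\<in>K. c a * ((indet\<^sup>2 - 1 - stay \<Gamma> s a) * ?X a + move \<Gamma> s a * ?X (?m a)) * ?Y a)"
    using K left by (subst pairing_superset[of K]) auto
  also have "\<dots> = (\<Sum>a\<in>K. c a * ?X a * ((indet\<^sup>2 - 1 - stay \<Gamma> s a) * ?Y a))
      + (\<Sum>a\<in>K. c a * (move \<Gamma> s a * ?X (?m a)) * ?Y a)"
    unfolding sum.distrib[symmetric] by (intro sum.cong) (auto simp: algebra_simps)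
  also have "\<dots> = (\<Sum>a\<in>K. c a * ?X a * ((indet\<^sup>2 - 1 - stay \<Gamma> s a) * ?Y a - move \<Gamma> s (?m a) * ?Y (?m a)))"
    unfolding swap sum.distrib[symmetric] by (intro sum.cong) (auto simp: algebra_simps)
  also have "\<dots> = pairing c x (theta s y)"
    using K right by (subst pairing_superset[of K]) auto
  finally show ?thesis .
qed

text \<open>
  By adjunction, the matrix entries of a product of the \<open>\<tau>'\<close> are, up to sign, entries of the reversed
  product of the \<open>\<theta>\<close>, and those agree for the two words.  The sign \<open>c\<close> depends on \<open>r\<close> and \<open>s\<close>.
\<close>
lemma two_letter_relation_rev:
  assumes rs: "r \<in> S" "s \<in> S" and xs: "xs \<in> lists {r, s}" and ys: "ys \<in> lists {r, s}"
    and len: "length xs = length ys"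
    and eq: "\<And>x. x \<in> V \<Longrightarrow> foldr (tau \<Gamma>) xs x = foldr (tau \<Gamma>) ys x" and x: "x \<in> V"
  shows "foldr (tau (rev_digraph \<Gamma>)) xs x = foldr (tau (rev_digraph \<Gamma>)) ys x"
proof -
  interpret rev: labeled_digraph_on S "rev_digraph \<Gamma>"
    by unfold_locales (rule labeled_rev)
  have S: "xs \<in> lists S" "ys \<in> lists S" using xs ys rs by auto
  obtain col :: "'v \<Rightarrow> bool" where
    col: "\<forall>a\<in>verts \<Gamma>. col (mate \<Gamma> r a) = (\<not> col a) \<and> col (mate \<Gamma> s a) = (\<not> col a)"
    using two_coloring_of_two_matchings[of "verts \<Gamma>" "mate \<Gamma> r" "mate \<Gamma> s"]
      mate_verts mate_mate mate_neq rs by metis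
  define c :: "'v \<Rightarrow> ratfun" where "c a = (if col a then 1 else - 1)" for a
  have adj: "pairing c (foldr (tau (rev_digraph \<Gamma>)) zs x) y = pairing c x (foldr theta (rev zs) y)"
    if "zs \<in> lists {r, s}" "y \<in> V" for zs y
    using that
  proof (induction zs arbitrary: y rule: list.induct)
    case (Cons t zs)
    then have t: "t \<in> S" "zs \<in> lists S" using rs by auto
    then have "foldr (tau (rev_digraph \<Gamma>)) zs x \<in> V" using rev.tau_word_closed[of zs x] x by simp
    moreover have "c (mate \<Gamma> t a) = - c a" if "a \<in> verts \<Gamma>" for a
    proof -
      have "t = r \<or> t = s" using Cons.prems(1) by simp
      then have "col (mate \<Gamma> t a) = (\<not> col a)" using col that by blast
      then show ?thesis by (simp add: c_def)
    qed
    ultimately show ?case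
      using Cons t pairing_tau_rev[of t "foldr (tau (rev_digraph \<Gamma>)) zs x" y c] by auto
  qed simp
  have "Poly_Mapping.lookup (foldr (tau (rev_digraph \<Gamma>)) xs x) a =
      Poly_Mapping.lookup (foldr (tau (rev_digraph \<Gamma>)) ys x) a" for a
  proof (cases "a \<in> verts \<Gamma>")
    case True
    have basis: "pairing c z (basis_vec a) = c a * Poly_Mapping.lookup z a" for z
      by (subst pairing_superset[of "{a}"]) (auto simp: basis_vec_def)
    have "pairing c (foldr (tau (rev_digraph \<Gamma>)) xs x) (basis_vec a)
        = pairing c (foldr (tau (rev_digraph \<Gamma>)) ys x) (basis_vec a)"
      using True theta_word_eq[OF S len eq, of "basis_vec a"] xs ys by (simp add: adj)
    then show ?thesis unfolding basis by (auto simp: c_def split: if_splits)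
  next
    case False
    moreover have "foldr (tau (rev_digraph \<Gamma>)) zs x \<in> V" if "zs \<in> lists S" for zs
      using that rev.tau_word_closed[of zs x] x by simp
    ultimately show ?thesis using S by (simp add: free_space_iff)
  qed
  then show ?thesis by (rule poly_mapping_eqI)
qed

end

section \<open>Representations of the Hecke algebra\<close>

locale hecke = coxeter_presentation W S n
  for W :: "('a, 'm) monoid_scheme" (structure) and S n +
  fixes H :: "('a \<Rightarrow>\<^sub>0 ratfun) ring"
  assumes hecke: "hecke_algebra W S H"
begin

sublocale H: ring H
  using hecke by (simp add: hecke_algebra_def)

lemma carrier_H: "carrier H = free_space (carrier W)"
  using hecke by (simp add: hecke_algebra_def)

lemma zero_H: "\<zero>\<^bsub>H\<^esub> = 0"
  using hecke by (simp add: hecke_algebra_def)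

lemma add_H: "x \<in> carrier H \<Longrightarrow> y \<in> carrier H \<Longrightarrow> x \<oplus>\<^bsub>H\<^esub> y = x + y"
  using hecke by (simp add: hecke_algebra_def)

lemma mult_scale:
  assumes "x \<in> carrier H" "y \<in> carrier H"
  shows "scale c x \<otimes>\<^bsub>H\<^esub> y = scale c (x \<otimes>\<^bsub>H\<^esub> y)" "x \<otimes>\<^bsub>H\<^esub> scale c y = scale c (x \<otimes>\<^bsub>H\<^esub> y)"
  using hecke assms unfolding hecke_algebra_def by blast+

lemma closed_H [simp]:
  "x \<in> carrier H \<Longrightarrow> scale c x \<in> carrier H"
  "x \<in> carrier H \<Longrightarrow> y \<in> carrier H \<Longrightarrow> x + y \<in> carrier H"
  "w \<in> carrier W \<Longrightarrow> basis_vec w \<in> carrier H"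
  by (simp_all add: carrier_H)

lemma mult_distrib:
  assumes "x \<in> carrier H" "y \<in> carrier H" "z \<in> carrier H"
  shows "(x + y) \<otimes>\<^bsub>H\<^esub> z = x \<otimes>\<^bsub>H\<^esub> z + y \<otimes>\<^bsub>H\<^esub> z" "z \<otimes>\<^bsub>H\<^esub> (x + y) = z \<otimes>\<^bsub>H\<^esub> x + z \<otimes>\<^bsub>H\<^esub> y"
  using assms H.l_distr[of x y z] H.r_distr[of x y z] by (simp_all add: add_H)

lemma T_mult_up:
  "s \<in> S \<Longrightarrow> w \<in> carrier W \<Longrightarrow> len (s \<otimes> w) > len w \<Longrightarrow>
    basis_vec s \<otimes>\<^bsub>H\<^esub> basis_vec w = basis_vec (s \<otimes> w)"
  using hecke by (simp add: hecke_algebra_def)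

lemma T_mult_down:
  "s \<in> S \<Longrightarrow> w \<in> carrier W \<Longrightarrow> len (s \<otimes> w) < len w \<Longrightarrow>
    basis_vec s \<otimes>\<^bsub>H\<^esub> basis_vec w =
      scale (indet\<^sup>2) (basis_vec (s \<otimes> w)) + scale (indet\<^sup>2 - 1) (basis_vec w)"
  using hecke by (simp add: hecke_algebra_def)

lemma T_quadratic:
  assumes s: "s \<in> S" and w: "w \<in> carrier W"
  shows "basis_vec s \<otimes>\<^bsub>H\<^esub> (basis_vec s \<otimes>\<^bsub>H\<^esub> basis_vec w) =
    scale (indet\<^sup>2) (basis_vec w) + scale (indet\<^sup>2 - 1) (basis_vec s \<otimes>\<^bsub>H\<^esub> basis_vec w)"
proof (cases "len (s \<otimes> w) > len w")
  case True
  then show ?thesis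
    using s w T_mult_up[of s w] T_mult_down[of s "s \<otimes> w"] by simp
next
  case False
  then have less: "len (s \<otimes> w) < len w" using len_generator_mult[OF s w] by auto
  have up: "basis_vec s \<otimes>\<^bsub>H\<^esub> basis_vec (s \<otimes> w) = basis_vec w"
    using s w less T_mult_up[of s "s \<otimes> w"] by simp
  let ?x = "scale (indet\<^sup>2) (basis_vec (s \<otimes> w)) + scale (indet\<^sup>2 - 1) (basis_vec w)"
  have "basis_vec s \<otimes>\<^bsub>H\<^esub> ?x =
      scale (indet\<^sup>2) (basis_vec s \<otimes>\<^bsub>H\<^esub> basis_vec (s \<otimes> w))
      + scale (indet\<^sup>2 - 1) (basis_vec s \<otimes>\<^bsub>H\<^esub> basis_vec w)"
    using s w by (simp add: mult_distrib mult_scale)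
  then show ?thesis unfolding up using T_mult_down[OF s w less] by metis
qed

lemma len_one: "len \<one> = 0"
  using len_le[of "[]"] by simp

text \<open>
  The unit of the algebra is not given in advance.  Evaluating \<open>T\<^sub>s T\<^sub>s T\<^sub>w\<close> in both ways
  shows that \<open>T\<^sub>e T\<^sub>w = T\<^sub>w\<close> for all \<open>w\<close>, so \<open>T\<^sub>e\<close> fixes the unit from the left.  Without
  generators there are no defining products, and \<open>T\<^sub>e\<close> may be any nonzero multiple of the unit.
\<close>
lemma T_one:
  assumes "S \<noteq> {}"
  shows "basis_vec \<one> = \<one>\<^bsub>H\<^esub>"
proof -
  obtain s where s: "s \<in> S" using assms by auto
  have "len (s \<otimes> \<one>) = Suc 0" using len_generator_mult[OF s one_closed] len_one by simp
  then have len_s: "len s = Suc 0" using s by simp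
  have "len (s \<otimes> s) = 0" using s len_one by simp
  then have ss: "basis_vec s \<otimes>\<^bsub>H\<^esub> basis_vec s =
      scale (indet\<^sup>2) (basis_vec \<one>) + scale (indet\<^sup>2 - 1) (basis_vec s)"
    using T_mult_down[of s s] len_s s by simp
  have T: "basis_vec \<one> \<otimes>\<^bsub>H\<^esub> basis_vec w = basis_vec w" if w: "w \<in> carrier W" for w
  proof -
    have "scale (indet\<^sup>2) (basis_vec \<one> \<otimes>\<^bsub>H\<^esub> basis_vec w) + scale (indet\<^sup>2 - 1) (basis_vec s \<otimes>\<^bsub>H\<^esub> basis_vec w)
        = (basis_vec s \<otimes>\<^bsub>H\<^esub> basis_vec s) \<otimes>\<^bsub>H\<^esub> basis_vec w"
      unfolding ss using s w by (simp add: mult_distrib mult_scale)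
    also have "\<dots> = basis_vec s \<otimes>\<^bsub>H\<^esub> (basis_vec s \<otimes>\<^bsub>H\<^esub> basis_vec w)"
      using s w by (intro H.m_assoc) auto
    also have "\<dots> = scale (indet\<^sup>2) (basis_vec w) + scale (indet\<^sup>2 - 1) (basis_vec s \<otimes>\<^bsub>H\<^esub> basis_vec w)"
      using T_quadratic[OF s w] .
    finally show ?thesis by (simp add: scale_cancel)
  qed
  have "basis_vec \<one> \<otimes>\<^bsub>H\<^esub> x = x" if "x \<in> free_space (carrier W)" for x
    using that
  proof (induction x rule: free_space_induct)
    case zero
    show ?case using H.r_null[of "basis_vec \<one>"] by (simp add: zero_H)
  next
    case (add x y)
    then show ?case by (simp add: mult_distrib carrier_H)
  next
    case (scale c a)
    then show ?case by (simp add: mult_scale T)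
  qed
  from this[of "\<one>\<^bsub>H\<^esub>"] have "basis_vec \<one> \<otimes>\<^bsub>H\<^esub> \<one>\<^bsub>H\<^esub> = \<one>\<^bsub>H\<^esub>"
    using H.one_closed by (simp add: carrier_H)
  then show ?thesis by simp
qed

lemma representation_reduced_word:
  assumes S: "S \<noteq> {}"
    and \<phi>: "\<phi> \<in> ring_hom H (operator_algebra (verts \<Gamma>))"
    and gen: "\<And>s. s \<in> S \<Longrightarrow> \<phi> (basis_vec s) = tau \<Gamma> s"
    and "reduced ss" and x: "x \<in> free_space (verts \<Gamma>)"
  shows "\<phi> (basis_vec (val ss)) x = foldr (tau \<Gamma>) ss x"
  using \<open>reduced ss\<close>
proof (induction ss)
  case Nil
  have "\<phi> (basis_vec \<one>) = (\<lambda>x\<in>free_space (verts \<Gamma>). x)"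
    using ring_hom_one[OF \<phi>] unfolding T_one[OF S] by (simp add: operator_algebra_def)
  then show ?case using x by simp
next
  case (Cons s ss)
  note red = reduced_Cons[OF Cons.prems]
  then have w: "val ss \<in> carrier W" by (simp add: reduced_def)
  have "basis_vec (val (s # ss)) = basis_vec s \<otimes>\<^bsub>H\<^esub> basis_vec (val ss)"
    using T_mult_up[of s "val ss"] red w by simp
  then have "\<phi> (basis_vec (val (s # ss))) = compose (free_space (verts \<Gamma>)) (tau \<Gamma> s) (\<phi> (basis_vec (val ss)))"
    using ring_hom_mult[OF \<phi>, of "basis_vec s" "basis_vec (val ss)"] red w gen
    by (simp add: operator_algebra_def)
  then show ?case using x Cons.IH red by (simp add: compose_def)
qed

text \<open>
  Matsumoto's theorem yields operators \<open>T w\<close> with \<open>T (s w) = \<tau>\<^sub>s (T w)\<close> whenever the length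
  grows; the quadratic relation gives the formula for the other case.  Hence the linear
  extension \<open>\<Phi>\<close> is compatible with left multiplication by the generators, and
  thereby with multiplication by each \<open>T\<^sub>w\<close>, which is a product of generators along a reduced word.
\<close>
lemma W_digraph_of_braid_relations:
  fixes \<Gamma> :: "('v, 'e, 'a) labeled_digraph"
  assumes S: "S \<noteq> {}" and labeled: "S_labeled_digraph S \<Gamma>"
    and braid: "\<And>r s k x. \<lbrakk>r \<in> S; s \<in> S; reduced (alternating_word r s k); reduced (alternating_word s r k);
      val (alternating_word r s k) = val (alternating_word s r k); x \<in> free_space (verts \<Gamma>)\<rbrakk>
      \<Longrightarrow> foldr (tau \<Gamma>) (alternating_word r s k) x = foldr (tau \<Gamma>) (alternating_word s r k) x"
  shows "W_digraph S H \<Gamma>"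
proof -
  interpret labeled_digraph_on S \<Gamma> by unfold_locales (rule labeled)
  define word where "word w = (SOME ss. reduced ss \<and> val ss = w)" for w
  have word: "reduced (word w)" "val (word w) = w" if "w \<in> carrier W" for w
    using someI_ex[OF reduced_word_exists[OF that]] by (simp_all add: word_def)
  have word_S: "word w \<in> lists S" if "w \<in> carrier W" for w using word(1)[OF that] by (simp add: reduced_def)
  define T where "T w x = foldr (tau \<Gamma>) (word w) x" for w x
  have T: "T (val ss) x = foldr (tau \<Gamma>) ss x" if red: "reduced ss" and x: "x \<in> V" for ss x
  proof -
    have w: "val ss \<in> carrier W" using red by (simp add: reduced_def)
    have "restrict (foldr (tau \<Gamma>) (word (val ss))) V = restrict (foldr (tau \<Gamma>) ss) V"
    proof (rule matsumoto_reduced_words[where F = "\<lambda>ss. restrict (foldr (tau \<Gamma>) ss) V", OF _ _ _ word(1)[OF w] red word(2)[OF w]])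
      fix s xs ys
      assume s: "s \<in> S" and "restrict (foldr (tau \<Gamma>) xs) V = restrict (foldr (tau \<Gamma>) ys) V"
      then have eq: "\<And>x. x \<in> V \<Longrightarrow> foldr (tau \<Gamma>) xs x = foldr (tau \<Gamma>) ys x"
        by (metis restrict_apply')
      show "restrict (foldr (tau \<Gamma>) (s # xs)) V = restrict (foldr (tau \<Gamma>) (s # ys)) V"
        by (rule restrict_ext) (simp add: eq)
      show "restrict (foldr (tau \<Gamma>) (xs @ [s])) V = restrict (foldr (tau \<Gamma>) (ys @ [s])) V"
        by (rule restrict_ext) (use s eq in simp)
    qed (auto intro!: restrict_ext braid)
    then show ?thesis using x unfolding T_def by (metis restrict_apply')
  qed
  have T_closed: "T w x \<in> V" if "w \<in> carrier W" "x \<in> V" for w x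
    using that word_S by (simp add: T_def)
  have T_up: "T (s \<otimes> w) x = tau \<Gamma> s (T w x)"
    if "s \<in> S" "w \<in> carrier W" "x \<in> V" "len w < len (s \<otimes> w)" for s w x
  proof -
    have "reduced (s # word w)" using that word by (intro reduced_ConsI) auto
    from T[OF this \<open>x \<in> V\<close>] show ?thesis using word[OF that(2)] by (simp add: T_def)
  qed
  define \<Phi> where "\<Phi> h x = linear_extension (\<lambda>w. T w x) h" for h x
  have \<Phi>_linear: "\<Phi> (g + h) x = \<Phi> g x + \<Phi> h x" "\<Phi> (scale c h) x = scale c (\<Phi> h x)"
      "\<Phi> 0 x = 0" "\<Phi> (basis_vec w) x = T w x" for g h x c w
    by (simp_all add: \<Phi>_def linear_extension_add linear_extension_scale)
  have \<Phi>_closed: "\<Phi> h x \<in> V" if "h \<in> carrier H" "x \<in> V" for h x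
    using that T_closed unfolding \<Phi>_def carrier_H by (intro linear_extension_closed) auto
  have \<Phi>_add: "\<Phi> h (x + y) = \<Phi> h x + \<Phi> h y" if "h \<in> carrier H" "x \<in> V" "y \<in> V" for h x y
    using that word_S unfolding \<Phi>_def linear_extension_fun_add[symmetric] carrier_H
    by (intro linear_extension_cong) (auto simp: T_def tau_word_linear)
  have \<Phi>_scale: "\<Phi> h (scale c x) = scale c (\<Phi> h x)" if "h \<in> carrier H" "x \<in> V" for h c x
    using that word_S unfolding \<Phi>_def linear_extension_fun_scale[symmetric] carrier_H
    by (intro linear_extension_cong) (auto simp: T_def tau_word_linear)
  have \<Phi>_one: "\<Phi> \<one>\<^bsub>H\<^esub> x = x" if "x \<in> V" for x
    using T[of "[]" x] that unfolding T_one[OF S, symmetric] \<Phi>_linear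
    by (simp add: reduced_def len_one)
  have \<Phi>_generator: "\<Phi> (basis_vec s) x = tau \<Gamma> s x" if "s \<in> S" "x \<in> V" for s x
  proof -
    have "reduced [s]"
      using that len_generator_mult[of s \<one>] len_one by (simp add: reduced_def)
    from T[OF this \<open>x \<in> V\<close>] show ?thesis using that by (simp add: \<Phi>_linear)
  qed
  have \<Phi>_generator_mult: "\<Phi> (basis_vec s \<otimes>\<^bsub>H\<^esub> h) x = tau \<Gamma> s (\<Phi> h x)"
    if s: "s \<in> S" and h: "h \<in> free_space (carrier W)" and x: "x \<in> V" for s h x
    using h
  proof (induction h rule: free_space_induct)
    case zero
    have "tau \<Gamma> s 0 = 0" using tau_linear(2)[of 0 s 0] by simp
    then show ?case using H.r_null[of "basis_vec s"] s by (simp add: zero_H \<Phi>_linear)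
  next
    case (add g h)
    then have gh: "g \<in> carrier H" "h \<in> carrier H" by (simp_all add: carrier_H)
    then show ?case
      using add s x \<Phi>_closed by (simp add: mult_distrib \<Phi>_linear tau_linear)
  next
    case (scale c w)
    have "\<Phi> (basis_vec s \<otimes>\<^bsub>H\<^esub> basis_vec w) x = tau \<Gamma> s (T w x)"
    proof (cases "len w < len (s \<otimes> w)")
      case True
      then show ?thesis using s scale x by (simp add: T_mult_up \<Phi>_linear T_up)
    next
      case False
      then have less: "len (s \<otimes> w) < len w" using len_generator_mult[OF s scale] by auto
      have "T w x = tau \<Gamma> s (T (s \<otimes> w) x)"
        using T_up[of s "s \<otimes> w" x] s scale x less by simp
      moreover have "T (s \<otimes> w) x \<in> V" using T_closed s scale x by simp
      ultimately show ?thesis using quadratic_relation[OF s, of "T (s \<otimes> w) x"]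
        unfolding T_mult_down[OF s scale less] \<Phi>_linear by simp
    qed
    then show ?case using s scale x T_closed by (simp add: mult_scale \<Phi>_linear tau_linear)
  qed
  have \<Phi>_word_mult: "\<Phi> (basis_vec (val ss) \<otimes>\<^bsub>H\<^esub> h) x = \<Phi> (basis_vec (val ss)) (\<Phi> h x)"
    if "reduced ss" "h \<in> carrier H" "x \<in> V" for ss h x
    using that
  proof (induction ss rule: list.induct)
    case Nil
    then show ?case using T_one[OF S] \<Phi>_one \<Phi>_closed by simp
  next
    case (Cons s ss)
    note red = reduced_Cons[OF Cons.prems(1)]
    then have w: "val ss \<in> carrier W" by (simp add: reduced_def)
    have eq: "basis_vec (val (s # ss)) = basis_vec s \<otimes>\<^bsub>H\<^esub> basis_vec (val ss)"
      using T_mult_up[of s "val ss"] red w by simp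
    have "basis_vec (val (s # ss)) \<otimes>\<^bsub>H\<^esub> h = basis_vec s \<otimes>\<^bsub>H\<^esub> (basis_vec (val ss) \<otimes>\<^bsub>H\<^esub> h)"
      unfolding eq using red w Cons.prems by (intro H.m_assoc) auto
    moreover have "basis_vec (val ss) \<otimes>\<^bsub>H\<^esub> h \<in> carrier H" using w Cons.prems by simp
    ultimately show ?case
      using \<Phi>_generator_mult[of s "basis_vec (val ss) \<otimes>\<^bsub>H\<^esub> h" x]
        \<Phi>_generator_mult[of s "basis_vec (val ss)" "\<Phi> h x"]
        Cons red w \<Phi>_closed unfolding eq by (simp add: carrier_H)
  qed
  have \<Phi>_mult: "\<Phi> (g \<otimes>\<^bsub>H\<^esub> h) x = \<Phi> g (\<Phi> h x)"
    if g: "g \<in> free_space (carrier W)" and h: "h \<in> carrier H" and x: "x \<in> V" for g h x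
    using g
  proof (induction g rule: free_space_induct)
    case zero
    then show ?case using H.l_null[OF h] by (simp add: zero_H \<Phi>_linear)
  next
    case (add g g')
    then show ?case using h by (simp add: mult_distrib carrier_H \<Phi>_linear)
  next
    case (scale c w)
    then show ?case
      using \<Phi>_word_mult[of "word w" h x] word h x by (simp add: mult_scale \<Phi>_linear)
  qed
  define \<phi> where "\<phi> h = restrict (\<Phi> h) V" for h
  have \<phi>_hom: "\<phi> \<in> ring_hom H (operator_algebra (verts \<Gamma>))"
  proof (rule ring_hom_memI)
    fix g assume g: "g \<in> carrier H"
    show "\<phi> g \<in> carrier (operator_algebra (verts \<Gamma>))"
      using g by (auto simp: operator_algebra_def linear_operators_def \<phi>_def \<Phi>_closed \<Phi>_add \<Phi>_scale)
    fix h assume h: "h \<in> carrier H"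
    show "\<phi> (g \<otimes>\<^bsub>H\<^esub> h) = \<phi> g \<otimes>\<^bsub>operator_algebra (verts \<Gamma>)\<^esub> \<phi> h"
      using g h by (auto simp: operator_algebra_def \<phi>_def compose_def \<Phi>_closed \<Phi>_mult carrier_H restrict_def fun_eq_iff)
    show "\<phi> (g \<oplus>\<^bsub>H\<^esub> h) = \<phi> g \<oplus>\<^bsub>operator_algebra (verts \<Gamma>)\<^esub> \<phi> h"
      using g h by (auto simp: operator_algebra_def \<phi>_def add_H \<Phi>_linear restrict_def fun_eq_iff)
  next
    show "\<phi> \<one>\<^bsub>H\<^esub> = \<one>\<^bsub>operator_algebra (verts \<Gamma>)\<^esub>"
      by (auto simp: operator_algebra_def \<phi>_def \<Phi>_one restrict_def fun_eq_iff)
  qed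
  have "\<phi> (scale c h) = scale_operator (verts \<Gamma>) c (\<phi> h)" for c h
    by (auto simp: scale_operator_def \<phi>_def \<Phi>_linear restrict_def fun_eq_iff)
  moreover have "\<phi> (basis_vec s) = tau \<Gamma> s" if "s \<in> S" for s
    using that \<Phi>_generator by (auto simp: \<phi>_def tau_def restrict_def fun_eq_iff)
  ultimately show ?thesis
    using labeled \<phi>_hom unfolding W_digraph_def by blast
qed

lemma W_digraph_rev:
  fixes \<Gamma> :: "('v, 'e, 'a) labeled_digraph"
  assumes "S_labeled_digraph S \<Gamma>" "W_digraph S H \<Gamma>"
  shows "W_digraph S H (rev_digraph \<Gamma>)"
proof -
  interpret labeled_digraph_on S \<Gamma> by unfold_locales fact
  obtain \<phi> where \<phi>: "\<phi> \<in> ring_hom H (operator_algebra (verts \<Gamma>))"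
      "\<forall>c. \<forall>x\<in>carrier H. \<phi> (scale c x) = scale_operator (verts \<Gamma>) c (\<phi> x)"
      "\<And>s. s \<in> S \<Longrightarrow> \<phi> (basis_vec s) = tau \<Gamma> s"
    using assms(2) unfolding W_digraph_def by blast
  show ?thesis
  \<comment> \<open>Without generators, the unit of the algebra need not be \<open>T\<^sub>e\<close>; but then the operators
    \<open>\<tau>\<^sub>s\<close> do not occur, and the given homomorphism serves for both digraphs.\<close>
  proof (cases "S = {}")
    case True
    then show ?thesis using \<phi> labeled_rev unfolding W_digraph_def by auto
  next
    case False
    show ?thesis
    proof (rule W_digraph_of_braid_relations[OF False labeled_rev])
      fix r s :: 'a and k and x :: "'v \<Rightarrow>\<^sub>0 ratfun"
      let ?xs = "alternating_word r s k" and ?ys = "alternating_word s r k"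
      assume rs: "r \<in> S" "s \<in> S" and red: "reduced ?xs" "reduced ?ys" "val ?xs = val ?ys"
        and x: "x \<in> free_space (verts (rev_digraph \<Gamma>))"
      have "foldr (tau \<Gamma>) ?xs y = foldr (tau \<Gamma>) ?ys y" if "y \<in> V" for y
        using representation_reduced_word[OF False \<phi>(1,3) red(1) that]
          representation_reduced_word[OF False \<phi>(1,3) red(2) that] red(3) by simp
      moreover have "?xs \<in> lists {r, s}" "?ys \<in> lists {r, s}"
        using set_alternating_word[of r s k] set_alternating_word[of s r k] by (auto simp: lists_eq_set)
      ultimately show "foldr (tau (rev_digraph \<Gamma>)) ?xs x = foldr (tau (rev_digraph \<Gamma>)) ?ys x"
        using rs x by (intro two_letter_relation_rev[of r s]) auto
    qed
  qed
qed

end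

theorem corollary1p4:
  fixes W :: "('a, 'm) monoid_scheme" and S :: "'a set"
    and H :: "('a \<Rightarrow>\<^sub>0 ratfun) ring"
    and \<Gamma> :: "('v, 'e, 'a) labeled_digraph"
  assumes "coxeter_system W S"
    and "hecke_algebra W S H"
    and "S_labeled_digraph S \<Gamma>"
  shows "W_digraph S H \<Gamma> \<longleftrightarrow> W_digraph S H (rev_digraph \<Gamma>)"
proof -
  obtain n where n: "\<forall>s\<in>S. n s s = 1" and pres: "has_presentation W S (coxeter_relators S n)"
    using assms(1) unfolding coxeter_system_def by blast
  interpret group W using pres by (simp add: has_presentation_def)
  interpret hecke W S n H
    by unfold_locales (use n pres assms(2) in auto)
  have "S_labeled_digraph S (rev_digraph \<Gamma>)"
    using assms(3) labeled_digraph_on.labeled_rev unfolding labeled_digraph_on_def by blast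
  then show ?thesis
    using W_digraph_rev[of \<Gamma>] W_digraph_rev[of "rev_digraph \<Gamma>"] assms(3) by auto
qed

end
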